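(* Let $M_1\in GL(2,\mathbb{Z})$ and $M_2\in GL(2,2\mathbb{Z})$ be expanding matrices with $|\det(M_2)|=4$, and set $M_n=M_2$ for all $n\ge2$. Let $t_1,t_2\in2\mathbb{Z}+1$, let $\mathcal{D}=\{(0,0)^t,(1,0)^t,(0,1)^t,(-1,-1)^t\}$, and let $D_1=t_1\mathcal{D}$ and $D_n=t_2\mathcal{D}$ for $n\ge2$. Then the Moran measure $$\mu_{\{M_n\},\{D_n\}}=\delta_{M_1^{-1}D_1}*\delta_{M_1^{-1}M_2^{-1}D_2}*\cdots*\delta_{M_1^{-1}M_2^{-1}\cdots M_n^{-1}D_n}*\cdots$$ is a spectral measure if and only if $t_2\mid t_1$.
   Context: $GL(2,\mathbb{Z})$ denotes the set of $2\times2$ matrices with integer entries and nonzero determinant (not necessarily $\pm1$); $GL(2,2\mathbb{Z})$ denotes the set of those with all entries in $2\mathbb{Z}$. A real square matrix is expanding if all its eigenvalues have modulus greater than one. For a finite set $E\subset\mathbb{R}^2$, $\delta_E=\frac1{\#E}\sum_{e\in E}\delta_e$, where $\delta_e$ is the point mass at $e$; $*$ is convolution of measures. The infinite convolution denotes the weak limit (a Borel probability measure) of the finite convolutions $\delta_{M_1^{-1}D_1}*\cdots*\delta_{M_1^{-1}\cdots M_n^{-1}D_n}$ as $n\to\infty$. A Borel measure $\mu$ on $\mathbb{R}^2$ is a spectral measure if there is a countable discrete set $\Lambda\subset\mathbb{R}^2$ (a spectrum of $\mu$) such that $\{e^{2\pi i\langle\lambda,x\rangle}\}_{\lambda\in\Lambda}$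 is an orthonormal basis of $L^2(\mu)$. *)

theory Defs
  imports "HOL-Probability.Probability"
begin

text \<open>Nonsingular matrices with entries in a set of reals; no unimodularity is required, so with
  entries in \<open>\<int>\<close> this is larger than the unit group of the integer matrix ring.\<close>

definition GL :: "real set \<Rightarrow> (real^'n^'n) set" where
  "GL R = {A. (\<forall>i j. A $ i $ j \<in> R) \<and> det A \<noteq> 0}"

definition even_integers :: "real set" where
  "even_integers = {2 * k | k. k \<in> \<int>}"

text \<open>Eigenvalues of a real matrix are taken in \<open>\<complex>\<close>.\<close>

definition is_eigenvalue :: "real^'n^'n \<Rightarrow> complex \<Rightarrow> bool" where
  "is_eigenvalue A z \<longleftrightarrow> (\<exists>v :: complex^'n. v \<noteq> 0 \<and> map_matrix complex_of_real A *v v = z *s v)"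

definition expanding :: "real^'n^'n \<Rightarrow> bool" where
  "expanding A \<longleftrightarrow> (\<forall>z. is_eigenvalue A z \<longrightarrow> cmod z > 1)"

text \<open>The uniform distribution on a finite set, as a measure on the Borel sigma-algebra
  (\<open>uniform_count_measure E\<close> itself lives on the power set of \<open>E\<close>).\<close>

definition point_masses :: "'a::topological_space set \<Rightarrow> 'a measure" where
  "point_masses E = distr (uniform_count_measure E) borel (\<lambda>x. x)"

lemma emeasure_point_masses:
  assumes "finite E" "A \<in> sets borel"
  shows "emeasure (point_masses E) A = (\<Sum>e\<in>E. emeasure (return borel e) A) / of_nat (card E)"
proof -
  have "emeasure (point_masses E) A = emeasure (uniform_count_measure E) (A \<inter> E)"
    using assms unfolding point_masses_def
    by (subst emeasure_distr) (auto simp: measurable_def space_uniform_count_measure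
        sets_uniform_count_measure)
  also have "\<dots> = of_nat (card (A \<inter> E)) / of_nat (card E)"
    using assms by (cases "E = {}")
      (auto simp: emeasure_uniform_count_measure ennreal_of_nat_eq_real_of_nat divide_ennreal
        card_gt_0_iff)
  also have "of_nat (card (A \<inter> E)) = (\<Sum>e\<in>E. emeasure (return borel e) A)"
    using assms by (simp add: indicator_def Int_def conj_commute)
  finally show ?thesis .
qed

text \<open>Sequences are indexed from 1; the value at 0 is never used. Thus
  \<open>inverse_product M n\<close> is \<open>(M 1)\<^sup>-\<^sup>1 (M 2)\<^sup>-\<^sup>1 \<cdots> (M n)\<^sup>-\<^sup>1\<close>, and the empty convolution is the
  point mass at 0, the neutral element of convolution.\<close>

primrec inverse_product :: "(nat \<Rightarrow> real^'n^'n) \<Rightarrow> nat \<Rightarrow> real^'n^'n" where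
  "inverse_product M 0 = mat 1"
| "inverse_product M (Suc n) = inverse_product M n ** matrix_inv (M (Suc n))"

primrec finite_convolution ::
    "(nat \<Rightarrow> real^'n^'n) \<Rightarrow> (nat \<Rightarrow> (real^'n) set) \<Rightarrow> nat \<Rightarrow> (real^'n) measure" where
  "finite_convolution M D 0 = return borel 0"
| "finite_convolution M D (Suc n) =
     convolution (finite_convolution M D n)
       (point_masses ((\<lambda>d. inverse_product M (Suc n) *v d) ` D (Suc n)))"

definition weakly_converges ::
    "(nat \<Rightarrow> 'a::topological_space measure) \<Rightarrow> 'a measure \<Rightarrow> bool" where
  "weakly_converges \<nu> \<mu> \<longleftrightarrow>
     (\<forall>f :: 'a \<Rightarrow> real. continuous_on UNIV f \<and> bounded (range f) \<longrightarrow>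
       (\<lambda>n. integral\<^sup>L (\<nu> n) f) \<longlonglongrightarrow> integral\<^sup>L \<mu> f)"

definition moran_measure ::
    "(nat \<Rightarrow> real^'n^'n) \<Rightarrow> (nat \<Rightarrow> (real^'n) set) \<Rightarrow> (real^'n) measure" where
  "moran_measure M D = (THE \<mu>. sets \<mu> = sets borel \<and> prob_space \<mu> \<and>
     weakly_converges (finite_convolution M D) \<mu>)"

definition L2 :: "'a measure \<Rightarrow> ('a \<Rightarrow> complex) set" where
  "L2 \<mu> = {f. f \<in> borel_measurable \<mu> \<and> integrable \<mu> (\<lambda>x. (cmod (f x))\<^sup>2)}"

text \<open>Orthonormal basis in the Hilbert space sense: an orthonormal family whose finite linear
  combinations are dense in \<open>L\<^sup>2(\<mu>)\<close>. Orthonormality is required of the family, so distinct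
  indices give distinct elements of \<open>L\<^sup>2(\<mu>)\<close>.\<close>

definition orthonormal_basis_L2 :: "'a measure \<Rightarrow> ('i \<Rightarrow> 'a \<Rightarrow> complex) \<Rightarrow> 'i set \<Rightarrow> bool" where
  "orthonormal_basis_L2 \<mu> e I \<longleftrightarrow>
     (\<forall>i\<in>I. e i \<in> L2 \<mu>) \<and>
     (\<forall>i\<in>I. \<forall>j\<in>I. (LINT x|\<mu>. e i x * cnj (e j x)) = (if i = j then 1 else 0)) \<and>
     (\<forall>f\<in>L2 \<mu>. \<forall>\<epsilon>>0. \<exists>F c. finite F \<and> F \<subseteq> I \<and>
        (LINT x|\<mu>. (cmod (f x - (\<Sum>i\<in>F. c i * e i x)))\<^sup>2) < \<epsilon>)"

definition is_spectrum :: "'a::euclidean_space measure \<Rightarrow> 'a set \<Rightarrow> bool" where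
  "is_spectrum \<mu> \<Lambda> \<longleftrightarrow> countable \<Lambda> \<and> topological_space_class.discrete \<Lambda> \<and>
     orthonormal_basis_L2 \<mu> (\<lambda>\<xi> x. exp (2 * of_real pi * \<i> * of_real (\<xi> \<bullet> x))) \<Lambda>"

definition spectral_measure :: "'a::euclidean_space measure \<Rightarrow> bool" where
  "spectral_measure \<mu> \<longleftrightarrow> sets \<mu> = sets borel \<and> (\<exists>\<Lambda>. is_spectrum \<mu> \<Lambda>)"

definition digits :: "(real^2) set" where
  "digits = {vector [0, 0], vector [1, 0], vector [0, 1], vector [-1, -1]}"

end

theory Submission
  imports Defs
begin

text \<open>
  Everything is read off from Fourier transforms. Write \<open>m\<close> for the transform of the uniform measure
  on the digits (\<open>digit_mask\<close>). Four unit complex numbers with product 1, one of which is 1,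
  sum to 0 only when another one is \<open>-1\<close>, so \<open>m\<close> vanishes exactly on the nonintegral points of the lattice \<open>(1/2)\<int>\<^sup>2\<close>. Let \<open>\<phi>\<close> be the
  transform of the self-affine measure \<open>\<sigma>\<close> of \<open>M\<^sub>2\<close> with the unscaled digits. The infinite product for
  the Moran measure \<open>\<mu>\<close> factors as \<open>m (t\<^sub>1 \<eta>) * \<phi> (t\<^sub>2 \<eta>)\<close>, where \<open>\<eta>\<close> is the image of the frequency under
  the inverse transpose of \<open>M\<^sub>1\<close>.

  Since \<open>M\<^sub>2\<close> is even with determinant \<open>\<plusminus>4\<close>, it is twice a unimodular matrix. The zeros of
  \<open>\<phi>\<close> are therefore exactly the nonzero integer points (\<open>fourier_zero_iff\<close>), so the exponentials
  with integer frequencies are orthonormal in \<open>L\<^sup>2(\<sigma>)\<close>. They are even an orthonormal basis: the sum \<open>Q\<close> of the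
  translates of \<open>\<bar>\<phi>\<bar>\<^sup>2\<close> over \<open>\<int>\<^sup>2\<close> is at most 1 by Bessel's inequality, attains its minimum because it is
  periodic and lower semicontinuous, and satisfies \<open>Q x = (\<Sum>h. \<bar>m (T x + h)\<bar>\<^sup>2 * Q (T x + h))\<close> with
  weights of total mass 1. A minimum outside the integer lattice is passed on to \<open>T x, T (T x), \<dots>\<close>,
  which tend to 0, where \<open>Q\<close> is bounded below by \<open>\<bar>\<phi>\<bar>\<^sup>2 \<rightarrow> 1\<close>. Hence \<open>Q = 1\<close> (\<open>power_sum_eq_1\<close>).

  An orthogonal family of exponentials is a basis exactly when Parseval's identity holds for
  every exponential, because trigonometric polynomials are dense in \<open>L\<^sup>2\<close> of a compactly supported measure
  (\<open>spectrum_complete\<close>, \<open>is_spectrumI\<close>). If \<open>t\<^sub>1 = t\<^sub>2 * s\<close>, then in the rescaled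
  frequency variable the transform of \<open>\<mu>\<close> is \<open>m (s \<eta>) * \<phi> \<eta>\<close>, and the lattice \<open>(1/2)\<int>\<^sup>2\<close> satisfies both conditions:
  a nonzero difference is either integral, hence a zero of \<open>\<phi>\<close>, or a zero of \<open>m\<close>, and Parseval's identity is
  \<open>Q = 1\<close> weighted with the values of \<open>\<bar>m\<bar>\<^sup>2\<close> on the four cosets (\<open>spectrum_if_dvd\<close>).

  Conversely, remove the common factor of \<open>t\<^sub>1\<close> and \<open>t\<^sub>2\<close>, so that the transform is
  \<open>m (p \<eta>) * \<phi> (q \<eta>)\<close> with coprime odd \<open>p\<close> and \<open>q\<close>, and suppose that \<open>\<bar>q\<bar> > 1\<close>. The known zeros force an
  orthogonal set into \<open>(1/q)\<int>\<^sup>2\<close> or into at most four translates of \<open>\<int>\<^sup>2\<close>. In both cases Parseval's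
  identity fails at a suitable frequency: the Parseval sum is bounded by a weighted sum of
  values of \<open>Q\<close> from which a positive term is missing (\<open>no_orthogonal_complete_set\<close>).
\<close>

section \<open>Exponentials and Fourier transforms of probability measures\<close>

definition character :: "'a::euclidean_space \<Rightarrow> 'a \<Rightarrow> complex" where
  "character \<xi> x = exp (2 * of_real pi * \<i> * of_real (\<xi> \<bullet> x))"

definition fourier :: "'a::euclidean_space measure \<Rightarrow> 'a \<Rightarrow> complex" where
  "fourier \<mu> \<xi> = (LINT x|\<mu>. character \<xi> x)"

lemma character_cis: "character \<xi> x = cis (2 * pi * (\<xi> \<bullet> x))"
  by (simp add: character_def cis_conv_exp mult_ac)

lemma norm_character [simp]: "cmod (character \<xi> x) = 1"
  by (simp add: character_cis)

lemma character_zero [simp]: "character 0 x = 1" "character \<xi> 0 = 1"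
  by (simp_all add: character_cis)

lemma character_add: "character (\<xi> + \<eta>) x = character \<xi> x * character \<eta> x"
  by (simp add: character_cis cis_mult inner_add_left algebra_simps)

lemma character_add_right: "character \<xi> (x + y) = character \<xi> x * character \<xi> y"
  by (simp add: character_cis cis_mult inner_add_right algebra_simps)

lemma cnj_character: "cnj (character \<xi> x) = character (- \<xi>) x"
  by (simp add: character_cis cis_cnj)

lemma character_times_cnj: "character \<xi> x * cnj (character \<eta> x) = character (\<xi> - \<eta>) x"
  using character_add[of \<xi> "- \<eta>" x] by (simp add: cnj_character)

lemma continuous_on_character [continuous_intros]: "continuous_on A (character \<xi>)"
  unfolding character_def[abs_def] by (intro continuous_intros)

lemma continuous_on_character_left: "continuous_on A (\<lambda>\<xi>. character \<xi> x)"
  unfolding character_def[abs_def] by (intro continuous_intros)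

lemma borel_measurable_character [measurable]: "character \<xi> \<in> borel_measurable borel"
  by (intro borel_measurable_continuous_onI continuous_intros)

locale borel_prob_space = prob_space \<mu> for \<mu> :: "'a::euclidean_space measure" +
  assumes sets_borel [measurable_cong, simp]: "sets \<mu> = sets borel"
begin

lemma space_UNIV [simp]: "space \<mu> = UNIV"
  using sets_eq_imp_space_eq[OF sets_borel] by simp

lemma prob_UNIV [simp]: "prob UNIV = 1"
  using prob_space by simp

lemma integrable_character [simp]: "integrable \<mu> (character \<xi>)"
  by (rule integrable_const_bound[where B = 1]) auto

lemma fourier_zero [simp]: "fourier \<mu> 0 = 1"
  by (simp add: fourier_def prob_space)

lemma fourier_minus: "fourier \<mu> (- \<xi>) = cnj (fourier \<mu> \<xi>)"
  unfolding fourier_def cnj_character[symmetric] by simp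

lemma continuous_on_fourier: "continuous_on UNIV (fourier \<mu>)"
  unfolding fourier_def
proof (rule continuous_on_eq_continuous_at[THEN iffD2, OF open_UNIV, rule_format])
  fix \<xi> :: 'a
  show "isCont (\<lambda>\<xi>. LINT x|\<mu>. character \<xi> x) \<xi>"
    unfolding continuous_at_sequentially comp_def
  proof (intro allI impI)
    fix u :: "nat \<Rightarrow> 'a" assume u: "u \<longlonglongrightarrow> \<xi>"
    show "(\<lambda>n. LINT x|\<mu>. character (u n) x) \<longlonglongrightarrow> (LINT x|\<mu>. character \<xi> x)"
    proof (rule integral_dominated_convergence[where w = "\<lambda>_. 1"])
      show "AE x in \<mu>. (\<lambda>n. character (u n) x) \<longlonglongrightarrow> character \<xi> x"
        by (intro AE_I2 continuous_on_tendsto_compose[OF continuous_on_character_left[of UNIV] u]) auto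
    qed auto
  qed
qed

text \<open>
  This is the Pythagorean theorem in \<open>L\<^sup>2(\<mu>)\<close>: the Fourier coefficients of one exponential with
  respect to the others are again values of the Fourier transform. All criteria for a
  spectrum below follow from this single formula, with the optimal choice of \<open>c\<close> or an arbitrary one.
\<close>

lemma orthogonal_energy_identity:
  assumes "finite F" and orth: "\<And>i j. i \<in> F \<Longrightarrow> j \<in> F \<Longrightarrow> i \<noteq> j \<Longrightarrow> fourier \<mu> (i - j) = 0"
  shows "(LINT x|\<mu>. (cmod (character \<xi> x - (\<Sum>i\<in>F. c i * character i x)))\<^sup>2)
    = 1 - (\<Sum>i\<in>F. (cmod (fourier \<mu> (\<xi> - i)))\<^sup>2) + (\<Sum>i\<in>F. (cmod (c i - fourier \<mu> (\<xi> - i)))\<^sup>2)"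
    (is "?L = ?R")
proof -
  let ?a = "\<lambda>i. fourier \<mu> (\<xi> - i)"
  have pt: "complex_of_real ((cmod (character \<xi> x - (\<Sum>i\<in>F. c i * character i x)))\<^sup>2)
     = 1 - (\<Sum>i\<in>F. cnj (c i) * character (\<xi> - i) x) - (\<Sum>i\<in>F. c i * character (i - \<xi>) x)
       + (\<Sum>i\<in>F. \<Sum>j\<in>F. c i * cnj (c j) * character (i - j) x)" for x
  proof -
    have "complex_of_real ((cmod (character \<xi> x - (\<Sum>i\<in>F. c i * character i x)))\<^sup>2)
      = (character \<xi> x - (\<Sum>i\<in>F. c i * character i x)) * cnj (character \<xi> x - (\<Sum>i\<in>F. c i * character i x))"
      by (simp only: complex_norm_square)
    also have "\<dots> = character \<xi> x * cnj (character \<xi> x)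
        - (\<Sum>i\<in>F. cnj (c i) * (character \<xi> x * cnj (character i x)))
        - (\<Sum>i\<in>F. c i * (character i x * cnj (character \<xi> x)))
        + (\<Sum>i\<in>F. \<Sum>j\<in>F. c i * cnj (c j) * (character i x * cnj (character j x)))"
      by (simp add: algebra_simps sum_distrib_left sum_distrib_right) (rule sum.swap)
    finally show ?thesis
      unfolding character_times_cnj by simp
  qed
  have "complex_of_real ?L = (LINT x|\<mu>. complex_of_real ((cmod (character \<xi> x - (\<Sum>i\<in>F. c i * character i x)))\<^sup>2))"
    by (rule integral_complex_of_real[symmetric])
  also have "\<dots> = 1 - (\<Sum>i\<in>F. cnj (c i) * ?a i) - (\<Sum>i\<in>F. c i * fourier \<mu> (i - \<xi>))
       + (\<Sum>i\<in>F. \<Sum>j\<in>F. c i * cnj (c j) * fourier \<mu> (i - j))"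
    unfolding pt fourier_def by (simp add: prob_space)
  also have "(\<Sum>i\<in>F. c i * fourier \<mu> (i - \<xi>)) = (\<Sum>i\<in>F. c i * cnj (?a i))"
    unfolding fourier_minus[symmetric] by simp
  also have "(\<Sum>i\<in>F. \<Sum>j\<in>F. c i * cnj (c j) * fourier \<mu> (i - j)) = (\<Sum>i\<in>F. c i * cnj (c i))"
  proof (rule sum.cong[OF refl])
    fix i assume i: "i \<in> F"
    have "(\<Sum>j\<in>F. c i * cnj (c j) * fourier \<mu> (i - j)) = (\<Sum>j\<in>F. if i = j then c i * cnj (c j) else 0)"
      by (rule sum.cong) (use orth i in auto)
    then show "(\<Sum>j\<in>F. c i * cnj (c j) * fourier \<mu> (i - j)) = c i * cnj (c i)"
      using i \<open>finite F\<close> by simp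
  qed
  also have "1 - (\<Sum>i\<in>F. cnj (c i) * ?a i) - (\<Sum>i\<in>F. c i * cnj (?a i)) + (\<Sum>i\<in>F. c i * cnj (c i))
     = 1 - (\<Sum>i\<in>F. ?a i * cnj (?a i)) + (\<Sum>i\<in>F. (c i - ?a i) * cnj (c i - ?a i))"
    by (simp add: algebra_simps sum.distrib sum_subtractf)
  also have "\<dots> = complex_of_real ?R"
    by (simp only: complex_norm_square of_real_add of_real_diff of_real_sum of_real_1)
  finally show ?thesis
    by (simp only: of_real_eq_iff)
qed

lemma bessel:
  assumes "finite F" "\<And>i j. i \<in> F \<Longrightarrow> j \<in> F \<Longrightarrow> i \<noteq> j \<Longrightarrow> fourier \<mu> (i - j) = 0"
  shows "(\<Sum>i\<in>F. (cmod (fourier \<mu> (\<xi> - i)))\<^sup>2) \<le> 1"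
proof -
  have "0 \<le> (LINT x|\<mu>. (cmod (character \<xi> x - (\<Sum>i\<in>F. fourier \<mu> (\<xi> - i) * character i x)))\<^sup>2)"
    by simp
  then show ?thesis
    by (subst (asm) orthogonal_energy_identity) (use assms in auto)
qed

end

section \<open>Density of trigonometric polynomials in \<open>L\<^sup>2\<close>\<close>

lemma L2_bounded:
  assumes "finite_measure \<mu>" "f \<in> borel_measurable \<mu>" "\<And>x. cmod (f x) \<le> B"
  shows "f \<in> L2 \<mu>"
proof -
  interpret finite_measure \<mu> by fact
  note [measurable] = assms(2)
  have "integrable \<mu> (\<lambda>x. (cmod (f x))\<^sup>2)"
    by (rule integrable_const_bound[where B = "B\<^sup>2"]) (auto intro!: power_mono assms(3))
  then show ?thesis using assms(2) by (simp add: L2_def)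
qed

lemma cmod_add_squared_le: "(cmod (a + b))\<^sup>2 \<le> 2 * (cmod a)\<^sup>2 + 2 * (cmod b)\<^sup>2"
proof -
  have "(cmod (a + b))\<^sup>2 \<le> (cmod a + cmod b)\<^sup>2"
    by (intro power_mono norm_triangle_ineq) auto
  also have "\<dots> \<le> 2 * (cmod a)\<^sup>2 + 2 * (cmod b)\<^sup>2"
    using zero_le_power2[of "cmod a - cmod b"] by (simp add: power2_sum power2_diff)
  finally show ?thesis .
qed

lemma L2_add:
  assumes f: "f \<in> L2 \<mu>" and g: "g \<in> L2 \<mu>"
  shows "(\<lambda>x. f x + g x) \<in> L2 \<mu>"
    and "(LINT x|\<mu>. (cmod (f x + g x))\<^sup>2) \<le> 2 * (LINT x|\<mu>. (cmod (f x))\<^sup>2) + 2 * (LINT x|\<mu>. (cmod (g x))\<^sup>2)"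
proof -
  have [measurable]: "f \<in> borel_measurable \<mu>" "g \<in> borel_measurable \<mu>"
    and [simp]: "integrable \<mu> (\<lambda>x. (cmod (f x))\<^sup>2)" "integrable \<mu> (\<lambda>x. (cmod (g x))\<^sup>2)"
    using f g by (auto simp: L2_def)
  have int: "integrable \<mu> (\<lambda>x. (cmod (f x + g x))\<^sup>2)"
    by (rule Bochner_Integration.integrable_bound[where f = "\<lambda>x. 2 * (cmod (f x))\<^sup>2 + 2 * (cmod (g x))\<^sup>2"])
      (auto simp: cmod_add_squared_le)
  then show "(\<lambda>x. f x + g x) \<in> L2 \<mu>" by (simp add: L2_def)
  have "(LINT x|\<mu>. (cmod (f x + g x))\<^sup>2) \<le> (LINT x|\<mu>. 2 * (cmod (f x))\<^sup>2 + 2 * (cmod (g x))\<^sup>2)"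
    by (rule integral_mono) (auto simp: int cmod_add_squared_le)
  then show "(LINT x|\<mu>. (cmod (f x + g x))\<^sup>2) \<le> 2 * (LINT x|\<mu>. (cmod (f x))\<^sup>2) + 2 * (LINT x|\<mu>. (cmod (g x))\<^sup>2)"
    by simp
qed

lemma L2_scale: "f \<in> L2 \<mu> \<Longrightarrow> (\<lambda>x. a * f x) \<in> L2 \<mu>"
  by (auto simp: L2_def norm_mult power_mult_distrib)

lemma L2_diff:
  assumes "f \<in> L2 \<mu>" "g \<in> L2 \<mu>"
  shows "(\<lambda>x. f x - g x) \<in> L2 \<mu>"
  using L2_add(1)[OF assms(1) L2_scale[OF assms(2), of "-1"]] by simp

lemma L2_sum: "finite F \<Longrightarrow> (\<And>i. i \<in> F \<Longrightarrow> f i \<in> L2 \<mu>) \<Longrightarrow> (\<lambda>x. \<Sum>i\<in>F. f i x) \<in> L2 \<mu>"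
proof (induction F rule: finite_induct)
  case empty
  then show ?case by (simp add: L2_def)
next
  case (insert i F)
  then have "(\<lambda>x. f i x + (\<Sum>i\<in>F. f i x)) \<in> L2 \<mu>"
    by (intro L2_add) auto
  then show ?case using insert by simp
qed

text \<open>
  The inductive form gives closure under products without bookkeeping of finite frequency
  sets, and closure of a class of functions under the three rules is all that is needed to
  contain the trigonometric polynomials.
\<close>

inductive trig_poly :: "('a::euclidean_space \<Rightarrow> complex) \<Rightarrow> bool" where
  character: "trig_poly (character \<xi>)"
| add: "trig_poly f \<Longrightarrow> trig_poly g \<Longrightarrow> trig_poly (\<lambda>x. f x + g x)"
| scale: "trig_poly f \<Longrightarrow> trig_poly (\<lambda>x. a * f x)"

lemma trig_poly_const: "trig_poly (\<lambda>x :: 'a::euclidean_space. a)"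
  using trig_poly.scale[OF trig_poly.character[of "0::'a"], of a] by simp

lemma continuous_on_trig_poly: "trig_poly f \<Longrightarrow> continuous_on A f"
  by (induction rule: trig_poly.induct) (auto intro!: continuous_intros)

lemma trig_poly_mult:
  assumes "trig_poly f" "trig_poly g"
  shows "trig_poly (\<lambda>x. f x * g x)"
  using assms
proof (induction arbitrary: g rule: trig_poly.induct)
  case (character \<xi>)
  then show ?case
  proof (induction rule: trig_poly.induct)
    case (character \<eta>)
    then show ?case using trig_poly.character[of "\<xi> + \<eta>"] by (simp add: character_add[abs_def])
  next
    case (add f g)
    then show ?case using trig_poly.add[OF add.IH] by (simp add: distrib_left)
  next
    case (scale f a)
    then show ?case using trig_poly.scale[OF scale.IH, of a] by (simp add: mult_ac)
  qed
next
  case (add f1 f2)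
  then show ?case using trig_poly.add[OF add.IH(1)[OF add.prems] add.IH(2)[OF add.prems]] by (simp add: distrib_right)
next
  case (scale f a)
  then show ?case using trig_poly.scale[OF scale.IH[OF scale.prems], of a] by (simp add: mult_ac)
qed

text \<open>
  The sine of frequency parallel to \<open>x - y\<close> vanishes at \<open>y\<close>; the length of the frequency is chosen
  so that the segment from \<open>y\<close> to \<open>x\<close> is a quarter of a period.
\<close>

lemma trig_poly_separates:
  fixes x y :: "'a::euclidean_space"
  assumes "x \<noteq> y"
  shows "\<exists>g :: 'a \<Rightarrow> real. trig_poly (\<lambda>z. complex_of_real (g z)) \<and> g x \<noteq> g y"
proof -
  define s where "s = 1 / (4 * (norm (x - y))\<^sup>2)"
  define \<xi> where "\<xi> = s *\<^sub>R (x - y)"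
  define g where "g z = sin (2 * pi * (\<xi> \<bullet> (z - y)))" for z
  have pos: "(norm (x - y))\<^sup>2 > 0" using assms by simp
  have "complex_of_real (g z) = (character \<xi> (- y) / (2 * \<i>)) * character \<xi> z
       + (- character (- \<xi>) (- y) / (2 * \<i>)) * character (- \<xi>) z" for z
  proof -
    have "sin w = (exp (\<i> * w) - exp (- \<i> * w)) / (2 * \<i>)" for w :: complex
      by (simp add: sin_exp_eq)
    from this[of "of_real (2 * pi * (\<xi> \<bullet> (z - y)))"]
    have "complex_of_real (g z) = (character \<xi> (z - y) - character (- \<xi>) (z - y)) / (2 * \<i>)"
      unfolding g_def character_def sin_of_real[symmetric] by (simp add: mult_ac)
    also have "\<dots> = (character \<xi> (- y) / (2 * \<i>)) * character \<xi> z
       + (- character (- \<xi>) (- y) / (2 * \<i>)) * character (- \<xi>) z"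
      using character_add_right[of \<xi> z "- y"] character_add_right[of "- \<xi>" z "- y"]
      by (simp add: diff_divide_distrib mult.commute)
    finally show ?thesis .
  qed
  then have "trig_poly (\<lambda>z. complex_of_real (g z))"
    by (simp only:) (intro trig_poly.intros)
  moreover have "g y = 0" by (simp add: g_def)
  moreover have "g x = 1"
  proof -
    have "\<xi> \<bullet> (x - y) = 1 / 4"
      using pos by (simp add: \<xi>_def s_def power2_norm_eq_inner[symmetric])
    then have "g x = sin (pi / 2)"
      unfolding g_def by (intro arg_cong[where f = sin]) simp
    then show ?thesis by simp
  qed
  ultimately show ?thesis by (intro exI[of _ g]) auto
qed

lemma trig_poly_dense_in_continuous:
  fixes h :: "'a::euclidean_space \<Rightarrow> real"
  assumes "compact S" "continuous_on S h" "\<epsilon> > 0"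
  obtains g :: "'a \<Rightarrow> real" where "trig_poly (\<lambda>z. complex_of_real (g z))" "\<And>x. x \<in> S \<Longrightarrow> \<bar>h x - g x\<bar> < \<epsilon>"
proof -
  have "\<exists>g. trig_poly (\<lambda>z. complex_of_real (g z)) \<and> (\<forall>x\<in>S. \<bar>h x - g x\<bar> < \<epsilon>)"
  proof (rule Stone_Weierstrass_HOL[OF \<open>compact S\<close> _ _ _ _ _ assms(2,3), of "\<lambda>g. trig_poly (\<lambda>z. complex_of_real (g z))"])
    fix f :: "'a \<Rightarrow> real" assume "trig_poly (\<lambda>z. complex_of_real (f z))"
    from continuous_on_trig_poly[OF this, of S]
    have "continuous_on S (\<lambda>z. Re (complex_of_real (f z)))" by (rule continuous_on_Re)
    then show "continuous_on S f" by simp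
  next
    fix f g :: "'a \<Rightarrow> real"
    assume "trig_poly (\<lambda>z. complex_of_real (f z)) \<and> trig_poly (\<lambda>z. complex_of_real (g z))"
    then show "trig_poly (\<lambda>z. complex_of_real (f z + g z))" "trig_poly (\<lambda>z. complex_of_real (f z * g z))"
      by (auto intro: trig_poly.add trig_poly_mult)
  next
    fix x y :: 'a assume "x \<in> S \<and> y \<in> S \<and> x \<noteq> y"
    then show "\<exists>f :: 'a \<Rightarrow> real. trig_poly (\<lambda>z. complex_of_real (f z)) \<and> f x \<noteq> f y"
      using trig_poly_separates by blast
  qed (rule trig_poly_const)
  then show ?thesis using that by blast
qed

text \<open>
  For closed \<open>A\<close> these continuous functions decrease to the indicator of \<open>A\<close>. They pass from continuous functions to
  closed sets, once for density in \<open>L\<^sup>2\<close> and once for the uniqueness of weak limits.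
\<close>

definition tent :: "'a::metric_space set \<Rightarrow> nat \<Rightarrow> 'a \<Rightarrow> real" where
  "tent A n x = max 0 (1 - real n * infdist x A)"

lemma continuous_on_tent: "continuous_on S (tent A n)"
  unfolding tent_def by (intro continuous_intros)

lemma borel_measurable_tent [measurable]: "tent A n \<in> borel_measurable borel"
  by (intro borel_measurable_continuous_onI continuous_on_tent)

lemma abs_tent_le_1: "\<bar>tent A n x\<bar> \<le> 1"
  using mult_nonneg_nonneg[OF of_nat_0_le_iff infdist_nonneg[of x A], of n]
  by (simp add: tent_def max_def)

lemma tent_tendsto_indicator:
  assumes "closed A" "A \<noteq> {}"
  shows "(\<lambda>n. tent A n x) \<longlonglongrightarrow> indicator A x"
proof (cases "x \<in> A")
  case True
  then show ?thesis by (simp add: tent_def)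
next
  case False
  then have d: "infdist x A > 0"
    using assms infdist_nonneg[of x A] in_closed_iff_infdist_zero[of A x] by (simp add: less_le)
  obtain N where N: "real N > 1 / infdist x A" using reals_Archimedean2 by blast
  have "tent A n x = 0" if "n \<ge> N" for n
  proof -
    have "real n > 1 / infdist x A" using N that by (meson less_le_trans of_nat_le_iff)
    then show ?thesis using d by (simp add: tent_def field_simps max_def)
  qed
  then have "eventually (\<lambda>n. tent A n x = indicator A x) sequentially"
    using False by (auto simp: eventually_sequentially)
  then show ?thesis by (rule tendsto_eventually)
qed

context borel_prob_space
begin

text \<open>
  Membership in the closed linear span in \<open>L\<^sup>2(\<mu>)\<close> of the exponentials with frequencies in \<open>\<Lambda>\<close>. Once
  this span contains every exponential it is all of \<open>L\<^sup>2(\<mu>)\<close> (\<open>approximable_all\<close>): it then contains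
  continuous functions by the Stone-Weierstrass theorem, indicators of closed sets as limits of tents,
  indicators of Borel sets by Dynkin's theorem, and finally limits of simple functions.
\<close>

definition approximable :: "'a set \<Rightarrow> ('a \<Rightarrow> complex) \<Rightarrow> bool" where
  "approximable \<Lambda> f \<longleftrightarrow> f \<in> L2 \<mu> \<and> (\<forall>\<epsilon>>0. \<exists>F c. finite F \<and> F \<subseteq> \<Lambda> \<and>
     (LINT x|\<mu>. (cmod (f x - (\<Sum>i\<in>F. c i * character i x)))\<^sup>2) < \<epsilon>)"

lemma approximable_L2: "approximable \<Lambda> f \<Longrightarrow> f \<in> L2 \<mu>"
  by (simp add: approximable_def)

lemma character_L2: "character \<xi> \<in> L2 \<mu>"
  by (rule L2_bounded[where B = 1]) (auto intro: finite_measure_axioms)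

lemma combination_L2: "finite F \<Longrightarrow> (\<lambda>x. \<Sum>i\<in>F. c i * character i x) \<in> L2 \<mu>"
  by (intro L2_sum L2_scale character_L2)

lemma approximable_add:
  assumes f: "approximable \<Lambda> f" and g: "approximable \<Lambda> g"
  shows "approximable \<Lambda> (\<lambda>x. f x + g x)"
  unfolding approximable_def
proof (intro conjI allI impI)
  show "(\<lambda>x. f x + g x) \<in> L2 \<mu>" using f g by (intro L2_add) (auto dest: approximable_L2)
  fix \<epsilon> :: real assume "\<epsilon> > 0"
  then have "\<epsilon> / 4 > 0" by simp
  from f this obtain F c where F: "finite F" "F \<subseteq> \<Lambda>"
      "(LINT x|\<mu>. (cmod (f x - (\<Sum>i\<in>F. c i * character i x)))\<^sup>2) < \<epsilon> / 4"
    unfolding approximable_def by blast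
  from g \<open>\<epsilon> / 4 > 0\<close> obtain G d where G: "finite G" "G \<subseteq> \<Lambda>"
      "(LINT x|\<mu>. (cmod (g x - (\<Sum>i\<in>G. d i * character i x)))\<^sup>2) < \<epsilon> / 4"
    unfolding approximable_def by blast
  define e where "e i = (if i \<in> F then c i else 0) + (if i \<in> G then d i else 0)" for i
  have "(\<Sum>i\<in>F \<union> G. e i * character i x) = (\<Sum>i\<in>F. c i * character i x) + (\<Sum>i\<in>G. d i * character i x)" for x
  proof -
    have "(\<Sum>i\<in>F. c i * character i x) = (\<Sum>i\<in>F \<union> G. (if i \<in> F then c i else 0) * character i x)"
      using F G by (intro sum.mono_neutral_cong_left) auto
    moreover have "(\<Sum>i\<in>G. d i * character i x) = (\<Sum>i\<in>F \<union> G. (if i \<in> G then d i else 0) * character i x)"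
      using F G by (intro sum.mono_neutral_cong_left) auto
    ultimately show ?thesis by (simp add: e_def distrib_right sum.distrib)
  qed
  then have "(LINT x|\<mu>. (cmod (f x + g x - (\<Sum>i\<in>F \<union> G. e i * character i x)))\<^sup>2)
     = (LINT x|\<mu>. (cmod ((f x - (\<Sum>i\<in>F. c i * character i x)) + (g x - (\<Sum>i\<in>G. d i * character i x))))\<^sup>2)"
    by (simp add: algebra_simps)
  also have "\<dots> \<le> 2 * (LINT x|\<mu>. (cmod (f x - (\<Sum>i\<in>F. c i * character i x)))\<^sup>2)
        + 2 * (LINT x|\<mu>. (cmod (g x - (\<Sum>i\<in>G. d i * character i x)))\<^sup>2)"
    using f g F(1) G(1) by (intro L2_add L2_diff combination_L2 approximable_L2)
  also have "\<dots> < \<epsilon>" using F G by simp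
  finally show "\<exists>F c. finite F \<and> F \<subseteq> \<Lambda> \<and> (LINT x|\<mu>. (cmod (f x + g x - (\<Sum>i\<in>F. c i * character i x)))\<^sup>2) < \<epsilon>"
    using F G by (intro exI[of _ "F \<union> G"] exI[of _ e]) auto
qed

lemma approximable_limit:
  assumes f: "f \<in> L2 \<mu>"
    and lim: "\<And>\<epsilon>. \<epsilon> > 0 \<Longrightarrow> \<exists>g. approximable \<Lambda> g \<and> (LINT x|\<mu>. (cmod (f x - g x))\<^sup>2) < \<epsilon>"
  shows "approximable \<Lambda> f"
  unfolding approximable_def
proof (intro conjI allI impI f)
  fix \<epsilon> :: real assume "\<epsilon> > 0"
  then have e: "\<epsilon> / 4 > 0" by simp
  from lim[OF e] obtain g where g: "approximable \<Lambda> g" "(LINT x|\<mu>. (cmod (f x - g x))\<^sup>2) < \<epsilon> / 4" by blast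
  from g(1) e obtain F c where F: "finite F" "F \<subseteq> \<Lambda>"
      "(LINT x|\<mu>. (cmod (g x - (\<Sum>i\<in>F. c i * character i x)))\<^sup>2) < \<epsilon> / 4"
    unfolding approximable_def by blast
  have "(LINT x|\<mu>. (cmod (f x - (\<Sum>i\<in>F. c i * character i x)))\<^sup>2)
     = (LINT x|\<mu>. (cmod ((f x - g x) + (g x - (\<Sum>i\<in>F. c i * character i x))))\<^sup>2)"
    by simp
  also have "\<dots> \<le> 2 * (LINT x|\<mu>. (cmod (f x - g x))\<^sup>2)
        + 2 * (LINT x|\<mu>. (cmod (g x - (\<Sum>i\<in>F. c i * character i x)))\<^sup>2)"
    using f approximable_L2[OF g(1)] F(1) by (intro L2_add L2_diff combination_L2)
  also have "\<dots> < \<epsilon>" using F g by simp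
  finally show "\<exists>F c. finite F \<and> F \<subseteq> \<Lambda> \<and> (LINT x|\<mu>. (cmod (f x - (\<Sum>i\<in>F. c i * character i x)))\<^sup>2) < \<epsilon>"
    using F by blast
qed

lemma approximable_scale:
  assumes f: "approximable \<Lambda> f"
  shows "approximable \<Lambda> (\<lambda>x. a * f x)"
  unfolding approximable_def
proof (intro conjI allI impI)
  show "(\<lambda>x. a * f x) \<in> L2 \<mu>" using f by (intro L2_scale approximable_L2)
  fix \<epsilon> :: real assume "\<epsilon> > 0"
  have pos: "(cmod a)\<^sup>2 + 1 > 0" by (simp add: add_nonneg_pos)
  with \<open>\<epsilon> > 0\<close> have "\<epsilon> / ((cmod a)\<^sup>2 + 1) > 0" by simp
  from f this obtain F c where F: "finite F" "F \<subseteq> \<Lambda>"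
      "(LINT x|\<mu>. (cmod (f x - (\<Sum>i\<in>F. c i * character i x)))\<^sup>2) < \<epsilon> / ((cmod a)\<^sup>2 + 1)" (is "?I < _")
    unfolding approximable_def by blast
  have "a * f x - (\<Sum>i\<in>F. (a * c i) * character i x) = a * (f x - (\<Sum>i\<in>F. c i * character i x))" for x
    by (simp add: algebra_simps sum_distrib_left)
  then have "(LINT x|\<mu>. (cmod (a * f x - (\<Sum>i\<in>F. (a * c i) * character i x)))\<^sup>2) = (cmod a)\<^sup>2 * ?I"
    by (simp add: norm_mult power_mult_distrib)
  also have "\<dots> \<le> ((cmod a)\<^sup>2 + 1) * ?I"
    by (intro mult_right_mono) auto
  also have "\<dots> < \<epsilon>" using F(3) unfolding pos_less_divide_eq[OF pos] by (simp add: mult.commute)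
  finally show "\<exists>F c. finite F \<and> F \<subseteq> \<Lambda> \<and> (LINT x|\<mu>. (cmod (a * f x - (\<Sum>i\<in>F. c i * character i x)))\<^sup>2) < \<epsilon>"
    using F by (intro exI[of _ F] exI[of _ "\<lambda>i. a * c i"]) simp
qed

lemma approximable_sequence:
  assumes "\<And>n. approximable \<Lambda> (s n)"
    and lim: "AE x in \<mu>. (\<lambda>n. s n x) \<longlonglongrightarrow> f x"
    and w: "integrable \<mu> w" "\<And>n x. (cmod (s n x))\<^sup>2 \<le> w x" 
    and f: "f \<in> L2 \<mu>"
  shows "approximable \<Lambda> f"
proof (rule approximable_limit[OF f])
  fix \<epsilon> :: real assume "\<epsilon> > 0"
  have [measurable]: "f \<in> borel_measurable \<mu>" using f by (simp add: L2_def)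
  have [measurable]: "s n \<in> borel_measurable \<mu>" for n
    using approximable_L2[OF assms(1)[of n]] by (simp add: L2_def)
  have "(\<lambda>n. LINT x|\<mu>. (cmod (f x - s n x))\<^sup>2) \<longlonglongrightarrow> (LINT x|\<mu>. 0)"
  proof (rule integral_dominated_convergence)
    show "integrable \<mu> (\<lambda>x. 2 * (cmod (f x))\<^sup>2 + 2 * w x)" using f w by (auto simp: L2_def)
    show "AE x in \<mu>. (\<lambda>n. (cmod (f x - s n x))\<^sup>2) \<longlonglongrightarrow> 0"
      using lim
    proof eventually_elim
      case (elim x)
      then have "(\<lambda>n. (cmod (f x - s n x))\<^sup>2) \<longlonglongrightarrow> (cmod (f x - f x))\<^sup>2" by (intro tendsto_intros)
      then show ?case by simp
    qed
    have "(cmod (f x - s n x))\<^sup>2 \<le> 2 * (cmod (f x))\<^sup>2 + 2 * w x" for x n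
      using cmod_add_squared_le[of "f x" "- s n x"] w(2)[of n x] by simp
    then show "AE x in \<mu>. norm ((cmod (f x - s n x))\<^sup>2) \<le> 2 * (cmod (f x))\<^sup>2 + 2 * w x" for n
      by simp
  qed auto
  then have "eventually (\<lambda>n. (LINT x|\<mu>. (cmod (f x - s n x))\<^sup>2) < \<epsilon>) sequentially"
    using \<open>\<epsilon> > 0\<close> by (intro order_tendstoD(2)) auto
  then show "\<exists>g. approximable \<Lambda> g \<and> (LINT x|\<mu>. (cmod (f x - g x))\<^sup>2) < \<epsilon>"
    using assms(1) by (auto simp: eventually_sequentially)
qed

context
  fixes \<Lambda> :: "'a set" and R :: real
  assumes characters: "\<And>\<xi>. approximable \<Lambda> (character \<xi>)"
    and support: "AE x in \<mu>. norm x \<le> R"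
begin

lemma approximable_trig_poly: "trig_poly f \<Longrightarrow> approximable \<Lambda> f"
  by (induction rule: trig_poly.induct) (auto intro: characters approximable_add approximable_scale)

text \<open>
  The measure has bounded support, so a uniform approximation on a ball by trigonometric polynomials is
  an approximation in \<open>L\<^sup>2(\<mu>)\<close>, however the polynomials behave outside the ball.
\<close>

lemma approximable_continuous:
  assumes h: "continuous_on UNIV h" and bound: "\<And>x. \<bar>h x\<bar> \<le> (1::real)"
  shows "approximable \<Lambda> (\<lambda>x. complex_of_real (h x))"
proof (rule approximable_limit)
  have h_meas [measurable]: "h \<in> borel_measurable borel" using h by (rule borel_measurable_continuous_onI)
  show "(\<lambda>x. complex_of_real (h x)) \<in> L2 \<mu>"
    by (rule L2_bounded[where B = 1]) (auto simp: bound intro: finite_measure_axioms)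
  fix \<epsilon> :: real assume e: "\<epsilon> > 0"
  define \<delta> where "\<delta> = sqrt (\<epsilon> / 2)"
  have \<delta>: "\<delta> > 0" "\<delta>\<^sup>2 = \<epsilon> / 2" using e by (auto simp: \<delta>_def)
  obtain g :: "'a \<Rightarrow> real" where g: "trig_poly (\<lambda>z. complex_of_real (g z))"
      "\<And>x. x \<in> cball 0 R \<Longrightarrow> \<bar>h x - g x\<bar> < \<delta>"
    using trig_poly_dense_in_continuous[OF compact_cball continuous_on_subset[OF h subset_UNIV] \<delta>(1)] by metis
  have "(LINT x|\<mu>. (cmod (complex_of_real (h x) - complex_of_real (g x)))\<^sup>2) \<le> (LINT x|\<mu>. \<delta>\<^sup>2)"
  proof (rule integral_mono_AE)
    show "integrable \<mu> (\<lambda>x. (cmod (complex_of_real (h x) - complex_of_real (g x)))\<^sup>2)"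
      using L2_diff[OF \<open>(\<lambda>x. complex_of_real (h x)) \<in> L2 \<mu>\<close> approximable_L2[OF approximable_trig_poly[OF g(1)]]]
      by (simp add: L2_def)
    show "AE x in \<mu>. (cmod (complex_of_real (h x) - complex_of_real (g x)))\<^sup>2 \<le> \<delta>\<^sup>2"
      using support
    proof eventually_elim
      case (elim x)
      then have "\<bar>h x - g x\<bar> \<le> \<delta>" using g(2)[of x] by simp
      then have "(cmod (complex_of_real (h x - g x)))\<^sup>2 \<le> \<delta>\<^sup>2"
        unfolding norm_of_real by (intro power_mono) auto
      then show ?case by simp
    qed
  qed simp
  also have "\<dots> < \<epsilon>" using \<delta> e by (simp add: prob_space)
  finally show "\<exists>g. approximable \<Lambda> g \<and> (LINT x|\<mu>. (cmod (complex_of_real (h x) - g x))\<^sup>2) < \<epsilon>"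
    using approximable_trig_poly[OF g(1)] by blast
qed

text \<open>
  The closed sets are stable under intersection and generate the Borel sets, and the closed linear
  span is stable under complements (it contains 1) and disjoint unions (by dominated convergence).
\<close>

lemma approximable_indicator:
  assumes "A \<in> sets borel"
  shows "approximable \<Lambda> (indicator A)"
proof -
  have L2_ind: "(indicator A :: 'a \<Rightarrow> complex) \<in> L2 \<mu>" if "A \<in> sets borel" for A
    by (rule L2_bounded[where B = 1]) (use that in \<open>auto simp: indicator_def intro: finite_measure_axioms\<close>)
  have "Int_stable (Collect closed :: 'a set set)" "Collect closed \<subseteq> Pow (UNIV :: 'a set)"
    and "A \<in> sigma_sets UNIV (Collect closed)"
    using assms unfolding borel_eq_closed by (auto simp: sets_measure_of Int_stable_def)
  then show ?thesis
  proof (induction rule: sigma_sets_induct_disjoint)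
    case (basic A)
    then have A: "closed A" by simp
    show ?case
    proof (cases "A = {}")
      case True
      then have "indicator A = (\<lambda>x::'a. 0 * character 0 x)" by auto
      then show ?thesis using approximable_scale[OF characters, of 0 0] by simp
    next
      case False
      show ?thesis
      proof (rule approximable_sequence[where s = "\<lambda>n x. complex_of_real (tent A n x)" and w = "\<lambda>_. 1"])
        show "approximable \<Lambda> (\<lambda>x. complex_of_real (tent A n x))" for n
          by (rule approximable_continuous[OF continuous_on_tent abs_tent_le_1])
        show "AE x in \<mu>. (\<lambda>n. complex_of_real (tent A n x)) \<longlonglongrightarrow> indicator A x"
        proof (intro AE_I2)
          fix x
          show "(\<lambda>n. complex_of_real (tent A n x)) \<longlonglongrightarrow> indicator A x"
            using tendsto_of_real[OF tent_tendsto_indicator[OF A False, of x], where 'a = complex]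
            by (cases "x \<in> A") auto
        qed
        show "(cmod (complex_of_real (tent A n x)))\<^sup>2 \<le> 1" for n x
          using power_mono[OF abs_tent_le_1[of A n x], of 2] by simp
        show "indicator A \<in> L2 \<mu>" using A by (intro L2_ind) auto
      qed simp
    qed
  next
    case empty
    have "indicator {} = (\<lambda>x::'a. 0 * character 0 x)" by auto
    then show ?case using approximable_scale[OF characters, of 0 0] by simp
  next
    case (compl A)
    have "indicator (UNIV - A) = (\<lambda>x::'a. character 0 x + (-1) * indicator A x :: complex)"
      by (auto simp: indicator_def)
    then show ?case using approximable_add[OF characters[of 0] approximable_scale[OF compl(2), of "-1"]] by simp
  next
    case (union A)
    have meas: "A i \<in> sets borel" for i
      using subsetD[OF union(2) rangeI, of i] unfolding borel_eq_closed by (simp add: sets_measure_of)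
    have sum: "(\<lambda>x. \<Sum>i<n. indicator (A i) x) = (indicator (\<Union>i<n. A i) :: 'a \<Rightarrow> complex)" for n
    proof
      fix x
      have "disjoint_family_on A {..<n}"
        using union(1) by (rule disjoint_family_on_mono[OF subset_UNIV])
      then show "(\<Sum>i<n. indicator (A i) x) = (indicator (\<Union>i<n. A i) x :: complex)"
        by (intro indicator_UN_disjoint[symmetric]) auto
    qed
    show ?case
    proof (rule approximable_sequence[where s = "\<lambda>n x. \<Sum>i<n. indicator (A i) x" and w = "\<lambda>_. 1"])
      show "approximable \<Lambda> (\<lambda>x. \<Sum>i<n. indicator (A i) x)" for n
      proof (induction n)
        case 0
        then show ?case using approximable_scale[OF characters, of 0 0] by simp
      next
        case (Suc n)
        then show ?case using approximable_add[OF Suc union(3)[of n]] by simp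
      qed
      show "AE x in \<mu>. (\<lambda>n. \<Sum>i<n. indicator (A i) x) \<longlonglongrightarrow> (indicator (\<Union> (range A)) x :: complex)"
      proof (intro AE_I2)
        fix x
        show "(\<lambda>n. \<Sum>i<n. indicator (A i) x) \<longlonglongrightarrow> (indicator (\<Union> (range A)) x :: complex)"
          unfolding fun_cong[OF sum] by (rule LIMSEQ_indicator_UN)
      qed
      show "(cmod (\<Sum>i<n. indicator (A i) x))\<^sup>2 \<le> 1" for n x
        unfolding fun_cong[OF sum] by (simp add: indicator_def)
      show "indicator (\<Union> (range A)) \<in> L2 \<mu>" using meas by (intro L2_ind) auto
    qed simp
  qed
qed

lemma approximable_all:
  assumes f: "f \<in> L2 \<mu>"
  shows "approximable \<Lambda> f"
proof -
  have [measurable]: "f \<in> borel_measurable \<mu>" using f by (simp add: L2_def)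
  from borel_measurable_implies_sequence_metric[OF this, of 0] obtain s where
    s: "\<And>i. simple_function \<mu> (s i)" and
    lim: "\<And>x. (\<lambda>i. s i x) \<longlonglongrightarrow> f x" and
    bound: "\<And>i x. norm (s i x) \<le> 2 * norm (f x)"
    by simp metis
  show ?thesis
  proof (rule approximable_sequence[where s = s and w = "\<lambda>x. 4 * (cmod (f x))\<^sup>2"])
    show "approximable \<Lambda> (s n)" for n
    proof -
      have fin: "finite (range (s n))" using s[of n] by (simp add: simple_function_def)
      have meas: "s n -` {y} \<in> sets borel" for y
        using measurable_sets[OF borel_measurable_simple_function[OF s[of n]], of "{y}"] by simp
      have part: "approximable \<Lambda> (\<lambda>x. \<Sum>y\<in>Y. y * indicator (s n -` {y}) x)" if "finite Y" for Y
        using that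
      proof (induction rule: finite_induct)
        case empty
        then show ?case using approximable_scale[OF characters, of 0 0] by simp
      next
        case (insert y Y)
        then show ?case
          using approximable_add[OF approximable_scale[OF approximable_indicator[OF meas[of y]], of y] insert.IH]
          by (simp only: sum.insert[OF insert.hyps])
      qed
      have "s n = (\<lambda>x. \<Sum>y\<in>range (s n). y * indicator (s n -` {y}) x)"
      proof
        fix x
        have "(\<Sum>y\<in>range (s n). y * indicator (s n -` {y}) x) = (\<Sum>y\<in>range (s n). if y = s n x then s n x else 0)"
          by (rule sum.cong) (auto simp: indicator_def)
        then show "s n x = (\<Sum>y\<in>range (s n). y * indicator (s n -` {y}) x)" using fin by simp
      qed
      then show ?thesis using part[OF fin] by simp
    qed
    show "(cmod (s n x))\<^sup>2 \<le> 4 * (cmod (f x))\<^sup>2" for n x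
      using power_mono[OF bound[of n x], of 2] by (simp add: power_mult_distrib)
  qed (use lim f in \<open>auto simp: L2_def\<close>)
qed

end

text \<open>
  The three lemmas that follow characterise spectra by the Fourier transform alone:
  its zeros contain the differences of the frequencies, and Parseval's identity
  holds for each exponential.
\<close>

lemma spectrum_orthogonal:
  assumes "is_spectrum \<mu> \<Lambda>" "i \<in> \<Lambda>" "j \<in> \<Lambda>" "i \<noteq> j"
  shows "fourier \<mu> (i - j) = 0"
  using assms
  unfolding is_spectrum_def orthonormal_basis_L2_def character_def[symmetric] fourier_def
    character_times_cnj by auto

text \<open>
  Any approximation of the exponential \<open>\<xi>\<close> within \<open>\<epsilon>\<close> is, by the energy identity, at best the
  orthogonal projection, whose error is the defect in Bessel's inequality.
\<close>

lemma spectrum_complete: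
  assumes spec: "is_spectrum \<mu> \<Lambda>" and "\<epsilon> > 0"
  obtains F where "finite F" "F \<subseteq> \<Lambda>" "(\<Sum>i\<in>F. (cmod (fourier \<mu> (\<xi> - i)))\<^sup>2) > 1 - \<epsilon>"
proof -
  have "approximable \<Lambda> (character \<xi>)"
    using spec character_L2
    unfolding is_spectrum_def orthonormal_basis_L2_def character_def[symmetric] approximable_def by blast
  with \<open>\<epsilon> > 0\<close> obtain F c where F: "finite F" "F \<subseteq> \<Lambda>"
    and less: "(LINT x|\<mu>. (cmod (character \<xi> x - (\<Sum>i\<in>F. c i * character i x)))\<^sup>2) < \<epsilon>"
    unfolding approximable_def by blast
  have "1 - (\<Sum>i\<in>F. (cmod (fourier \<mu> (\<xi> - i)))\<^sup>2) + (\<Sum>i\<in>F. (cmod (c i - fourier \<mu> (\<xi> - i)))\<^sup>2) < \<epsilon>"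
    using less by (subst (asm) orthogonal_energy_identity[OF F(1)])
      (use F(2) spectrum_orthogonal[OF spec] in auto)
  moreover have "(\<Sum>i\<in>F. (cmod (c i - fourier \<mu> (\<xi> - i)))\<^sup>2) \<ge> 0"
    by (intro sum_nonneg) auto
  ultimately have "(\<Sum>i\<in>F. (cmod (fourier \<mu> (\<xi> - i)))\<^sup>2) > 1 - \<epsilon>" by linarith
  then show ?thesis using F that by blast
qed

lemma is_spectrumI:
  assumes support: "AE x in \<mu>. norm x \<le> R"
    and "countable \<Lambda>" "topological_space_class.discrete \<Lambda>"
    and orth: "\<And>i j. i \<in> \<Lambda> \<Longrightarrow> j \<in> \<Lambda> \<Longrightarrow> i \<noteq> j \<Longrightarrow> fourier \<mu> (i - j) = 0"
    and complete: "\<And>\<xi> \<epsilon>. \<epsilon> > 0 \<Longrightarrow> \<exists>F. finite F \<and> F \<subseteq> \<Lambda> \<and> (\<Sum>i\<in>F. (cmod (fourier \<mu> (\<xi> - i)))\<^sup>2) > 1 - \<epsilon>"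
  shows "is_spectrum \<mu> \<Lambda>"
proof -
  have chars: "approximable \<Lambda> (character \<xi>)" for \<xi>
    unfolding approximable_def
  proof (intro conjI allI impI character_L2)
    fix \<epsilon> :: real assume "\<epsilon> > 0"
    from complete[OF this, of \<xi>] obtain F where F: "finite F" "F \<subseteq> \<Lambda>"
      and "(\<Sum>i\<in>F. (cmod (fourier \<mu> (\<xi> - i)))\<^sup>2) > 1 - \<epsilon>" by blast
    then have "(LINT x|\<mu>. (cmod (character \<xi> x - (\<Sum>i\<in>F. fourier \<mu> (\<xi> - i) * character i x)))\<^sup>2) < \<epsilon>"
      by (subst orthogonal_energy_identity) (use orth in auto)
    with F show "\<exists>F c. finite F \<and> F \<subseteq> \<Lambda> \<and> (LINT x|\<mu>. (cmod (character \<xi> x - (\<Sum>i\<in>F. c i * character i x)))\<^sup>2) < \<epsilon>"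
      by (intro exI[of _ F] exI[of _ "\<lambda>i. fourier \<mu> (\<xi> - i)"]) simp
  qed
  have "orthonormal_basis_L2 \<mu> character \<Lambda>"
    unfolding orthonormal_basis_L2_def character_times_cnj fourier_def[symmetric]
  proof (intro conjI ballI allI impI)
    fix f and \<epsilon> :: real assume "f \<in> L2 \<mu>" "\<epsilon> > 0"
    then show "\<exists>F c. finite F \<and> F \<subseteq> \<Lambda> \<and> (LINT x|\<mu>. (cmod (f x - (\<Sum>i\<in>F. c i * character i x)))\<^sup>2) < \<epsilon>"
      using approximable_all[OF chars support, of f] unfolding approximable_def by blast
  qed (use orth character_L2 in auto)
  then show ?thesis
    using assms(2,3) unfolding is_spectrum_def character_def[symmetric] by blast
qed

end

section \<open>Infinite convolutions and Moran measures\<close>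

lemma borel_prob_spaceI: "prob_space \<mu> \<Longrightarrow> sets \<mu> = sets borel \<Longrightarrow> borel_prob_space \<mu>"
  by (simp add: borel_prob_space_def borel_prob_space_axioms_def)

text \<open>
  The tents of a closed set determine its measure, and closed sets determine a finite Borel measure.
\<close>

lemma weak_limit_unique:
  fixes \<mu> \<mu>' :: "'a::euclidean_space measure"
  assumes "borel_prob_space \<mu>" "borel_prob_space \<mu>'"
    and conv: "weakly_converges \<nu> \<mu>" "weakly_converges \<nu> \<mu>'"
  shows "\<mu> = \<mu>'"
proof -
  interpret A: borel_prob_space \<mu> by fact
  interpret B: borel_prob_space \<mu>' by fact
  have tent_eq: "integral\<^sup>L \<mu> (tent C n) = integral\<^sup>L \<mu>' (tent C n)" for C n
  proof -
    have "bounded (range (tent C n))"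
      using abs_tent_le_1[of C n] by (auto simp: bounded_iff)
    then show ?thesis
      using conv continuous_on_tent[of UNIV C n] LIMSEQ_unique unfolding weakly_converges_def by blast
  qed
  have lim: "(\<lambda>n. integral\<^sup>L \<rho> (tent C n)) \<longlonglongrightarrow> measure \<rho> C"
    if "closed C" "C \<noteq> {}" and "borel_prob_space \<rho>" for C and \<rho> :: "'a measure"
  proof -
    interpret R: borel_prob_space \<rho> by fact
    have "(\<lambda>n. integral\<^sup>L \<rho> (tent C n)) \<longlonglongrightarrow> (LINT x|\<rho>. indicator C x)"
    proof (rule integral_dominated_convergence[where w = "\<lambda>_. 1"])
      show "AE x in \<rho>. (\<lambda>n. tent C n x) \<longlonglongrightarrow> indicator C x"
        using tent_tendsto_indicator[OF that(1,2)] by simp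
      show "AE x in \<rho>. norm (tent C n x) \<le> 1" for n
        by (intro AE_I2) (simp add: abs_tent_le_1)
      show "tent C n \<in> borel_measurable \<rho>" for n
        by measurable
      show "(indicator C :: 'a \<Rightarrow> real) \<in> borel_measurable \<rho>"
        using that(1) by (intro borel_measurable_indicator) auto
    qed auto
    then show ?thesis using that(1) by simp
  qed
  have closed_eq: "emeasure \<mu> C = emeasure \<mu>' C" if "closed C" for C
  proof (cases "C = {}")
    case False
    have "measure \<mu> C = measure \<mu>' C"
      using LIMSEQ_unique[OF lim[OF that False assms(1)]] lim[OF that False assms(2)] tent_eq by simp
    then show ?thesis by (simp add: A.emeasure_eq_measure B.emeasure_eq_measure)
  qed simp
  show ?thesis
  proof (rule measure_eqI_generator_eq[where E = "Collect closed" and \<Omega> = UNIV and A = "\<lambda>_. UNIV"])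
    show "sets \<mu> = sigma_sets UNIV (Collect closed)" "sets \<mu>' = sigma_sets UNIV (Collect closed)"
      by (simp_all add: borel_eq_closed sets_measure_of)
  qed (use B.emeasure_finite in \<open>auto simp: Int_stable_def closed_eq\<close>)
qed

lemma prob_point_masses:
  fixes E :: "'a::euclidean_space set"
  assumes "finite E" "E \<noteq> {}"
  shows "borel_prob_space (point_masses E)"
proof (rule borel_prob_spaceI)
  have "prob_space (uniform_count_measure E)" using assms by (rule prob_space_uniform_count_measure)
  then show "prob_space (point_masses E)" unfolding point_masses_def
    by (rule prob_space.prob_space_distr)
      (auto simp: measurable_def sets_uniform_count_measure space_uniform_count_measure)
qed (simp add: point_masses_def)

lemma AE_point_masses:
  fixes E :: "'a::euclidean_space set"
  assumes "finite E"
  shows "AE x in point_masses E. x \<in> E"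
proof -
  have "E \<in> sets borel" using assms by (intro borel_closed finite_imp_closed)
  then show ?thesis unfolding point_masses_def
    by (subst AE_distr_iff)
      (auto simp: measurable_def sets_uniform_count_measure space_uniform_count_measure intro: AE_I2)
qed

lemma fourier_point_masses:
  fixes E :: "'a::euclidean_space set"
  assumes "finite E"
  shows "fourier (point_masses E) \<xi> = (\<Sum>e\<in>E. character \<xi> e) / of_nat (card E)"
proof -
  have "fourier (point_masses E) \<xi> = (LINT x|uniform_count_measure E. character \<xi> x)"
    unfolding fourier_def point_masses_def
    by (intro integral_distr borel_measurable_character)
      (auto simp: measurable_def sets_uniform_count_measure space_uniform_count_measure)
  also have "\<dots> = (\<Sum>e\<in>E. (1 / card E) *\<^sub>R character \<xi> e)"
    unfolding uniform_count_measure_def using assms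
    by (subst lebesgue_integral_point_measure_finite) auto
  also have "\<dots> = (\<Sum>e\<in>E. character \<xi> e) / of_nat (card E)"
    by (simp add: sum_divide_distrib scaleR_conv_of_real)
  finally show ?thesis .
qed

lemma fourier_convolution:
  fixes \<mu> \<nu> :: "'a::ordered_euclidean_space measure"
  assumes "borel_prob_space \<mu>" "borel_prob_space \<nu>"
  shows "fourier (convolution \<mu> \<nu>) \<xi> = fourier \<mu> \<xi> * fourier \<nu> \<xi>"
proof -
  interpret A: borel_prob_space \<mu> by fact
  interpret B: borel_prob_space \<nu> by fact
  interpret P: pair_prob_space \<mu> \<nu> ..
  have "fourier (convolution \<mu> \<nu>) \<xi> = (LINT z|(\<mu> \<Otimes>\<^sub>M \<nu>). character \<xi> (fst z + snd z))"
    unfolding fourier_def convolution_def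
    by (subst integral_distr) (auto simp: case_prod_beta)
  also have "\<dots> = (LINT x|\<mu>. LINT y|\<nu>. character \<xi> (x + y))"
    by (subst P.integral_fst'[symmetric])
      (auto intro!: P.integrable_const_bound[where B = 1])
  also have "\<dots> = fourier \<mu> \<xi> * fourier \<nu> \<xi>"
    by (simp add: character_add_right fourier_def)
  finally show ?thesis .
qed

lemma fourier_weak_limit:
  assumes "\<And>n. borel_prob_space (\<nu> n)" "borel_prob_space \<mu>" "weakly_converges \<nu> \<mu>"
  shows "(\<lambda>n. fourier (\<nu> n) \<xi>) \<longlonglongrightarrow> fourier \<mu> \<xi>"
proof -
  have parts: "fourier \<rho> \<xi> = Complex (LINT x|\<rho>. Re (character \<xi> x)) (LINT x|\<rho>. Im (character \<xi> x))"
    if "borel_prob_space \<rho>" for \<rho> :: "'a measure"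
  proof -
    interpret borel_prob_space \<rho> by fact
    show ?thesis by (simp add: fourier_def complex_eq_iff)
  qed
  have "bounded (range (\<lambda>x. Re (character \<xi> x)))" "bounded (range (\<lambda>x. Im (character \<xi> x)))"
    using abs_Re_le_cmod[of "character \<xi> _"] abs_Im_le_cmod[of "character \<xi> _"]
    by (auto simp: bounded_iff intro!: exI[of _ 1])
  then have "(\<lambda>n. LINT x|\<nu> n. Re (character \<xi> x)) \<longlonglongrightarrow> (LINT x|\<mu>. Re (character \<xi> x))"
    "(\<lambda>n. LINT x|\<nu> n. Im (character \<xi> x)) \<longlonglongrightarrow> (LINT x|\<mu>. Im (character \<xi> x))"
    using assms(3) continuous_on_Re[OF continuous_on_character] continuous_on_Im[OF continuous_on_character]
    unfolding weakly_converges_def by blast+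
  then show ?thesis
    unfolding parts[OF assms(1)] parts[OF assms(2)] by (rule tendsto_Complex)
qed

text \<open>
  The limit is the distribution of the random series of independent digits, realised as the coordinates of a product
  space. The bounds make this series converge almost surely, so the partial sums, whose distributions are
  the finite convolutions, converge in distribution.
\<close>

lemma infinite_convolution_exists:
  fixes E :: "nat \<Rightarrow> 'a::ordered_euclidean_space set" and \<nu> :: "nat \<Rightarrow> 'a measure"
  assumes E: "\<And>n. finite (E n)" "\<And>n. E n \<noteq> {}"
    and bound: "\<And>n e. e \<in> E n \<Longrightarrow> norm e \<le> b n" and "summable b"
    and \<nu>_0: "\<nu> 0 = return borel 0"
    and \<nu>_Suc: "\<And>n. \<nu> (Suc n) = convolution (\<nu> n) (point_masses (E n))"
  obtains \<mu> where "borel_prob_space \<mu>" "weakly_converges \<nu> \<mu>" "AE x in \<mu>. norm x \<le> suminf b"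
proof -
  let ?K = "\<lambda>n. point_masses (E n)"
  define P where "P = PiM UNIV ?K"
  have K: "borel_prob_space (?K n)" for n using E by (rule prob_point_masses)
  have K_sets [simp, measurable_cong]: "sets (?K n) = sets borel" for n by (simp add: point_masses_def)
  interpret K: prob_space "?K n" for n using K by (simp add: borel_prob_space_def)
  interpret PP: product_prob_space ?K UNIV ..
  interpret P: prob_space P unfolding P_def by (intro prob_space_PiM K.prob_space_axioms)
  have coord [measurable]: "(\<lambda>\<omega>. \<omega> n) \<in> borel_measurable P" for n
    unfolding P_def by measurable
  have distr_coord: "distr P borel (\<lambda>\<omega>. \<omega> n) = ?K n" for n
    unfolding P_def using PP.PiM_component[of n] by (metis K_sets UNIV_I distr_cong)
  have indep: "P.indep_vars (\<lambda>_. borel) (\<lambda>n \<omega>. \<omega> n) UNIV"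
  proof (subst P.indep_vars_iff_distr_eq_PiM')
    have "distr P (Pi\<^sub>M UNIV (\<lambda>_. borel)) (\<lambda>x. x) = P"
      by (rule distr_id2) (auto simp: P_def intro!: sets_PiM_cong)
    then show "distr P (Pi\<^sub>M UNIV (\<lambda>_. borel)) (\<lambda>x. \<lambda>i\<in>UNIV. x i) = Pi\<^sub>M UNIV (\<lambda>i. distr P borel (\<lambda>\<omega>. \<omega> i))"
      unfolding distr_coord by (simp add: P_def restrict_UNIV)
  qed auto
  define S where "S n \<omega> = (\<Sum>i<n. \<omega> i)" for n and \<omega> :: "nat \<Rightarrow> 'a"
  have [measurable]: "S n \<in> borel_measurable P" for n unfolding S_def by measurable
  have distr_S: "distr P borel (S n) = \<nu> n" for n
  proof (induction n)
    case 0
    have "distr P borel (\<lambda>\<omega>. 0) = return borel (0::'a)" by (rule P.distr_const) simp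
    then show ?case by (simp add: S_def[abs_def] \<nu>_0)
  next
    case (Suc n)
    have "P.indep_var borel ((\<lambda>f. \<Sum>i<n. f i) \<circ> (\<lambda>\<omega>. restrict (\<lambda>i. \<omega> i) {..<n}))
        borel ((\<lambda>f. f n) \<circ> (\<lambda>\<omega>. restrict (\<lambda>i. \<omega> i) {n}))"
      by (intro P.indep_var_compose[OF P.indep_var_restrict[OF indep]]) auto
    also have "(\<lambda>f. \<Sum>i<n. f i) \<circ> (\<lambda>\<omega>. restrict (\<lambda>i. \<omega> i) {..<n}) = S n"
      by (auto simp: S_def fun_eq_iff)
    also have "(\<lambda>f. f n) \<circ> (\<lambda>\<omega>. restrict (\<lambda>i. \<omega> i) {n}) = (\<lambda>\<omega>. \<omega> n)" by auto
    finally have "distr P borel (\<lambda>\<omega>. S n \<omega> + \<omega> n) = convolution (distr P borel (S n)) (distr P borel (\<lambda>\<omega>. \<omega> n))"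
      by (rule P.sum_indep_random_variable) auto
    then show ?case unfolding Suc distr_coord \<nu>_Suc[symmetric] by (simp add: S_def[abs_def])
  qed
  define X where "X \<omega> = suminf \<omega>" for \<omega> :: "nat \<Rightarrow> 'a"
  have [measurable]: "X \<in> borel_measurable P"
    unfolding X_def[abs_def] by measurable
  have "AE \<omega> in P. \<forall>n. norm (\<omega> n) \<le> b n"
  proof (rule AE_all_countable[THEN iffD2], rule allI)
    fix n
    have "AE x in ?K n. norm x \<le> b n"
      using AE_point_masses[OF E(1)] by eventually_elim (rule bound)
    then show "AE \<omega> in P. norm (\<omega> n) \<le> b n"
      unfolding P_def by (intro PP.AE_component) auto
  qed
  then have lim: "AE \<omega> in P. (\<lambda>n. S n \<omega>) \<longlonglongrightarrow> X \<omega> \<and> norm (X \<omega>) \<le> suminf b"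
  proof eventually_elim
    case (elim \<omega>)
    then have sb: "norm (\<omega> n) \<le> b n" for n by simp
    have "summable \<omega>" using \<open>summable b\<close> sb by (rule summable_comparison_test'[of _ 0])
    then show ?case
      using summable_LIMSEQ norm_suminf_le[OF sb \<open>summable b\<close>] by (auto simp: S_def X_def)
  qed
  show ?thesis
  proof (rule that)
    show "borel_prob_space (distr P borel X)"
      by (intro borel_prob_spaceI P.prob_space_distr) auto
    show "AE x in distr P borel X. norm x \<le> suminf b"
      using lim by (subst AE_distr_iff) auto
    show "weakly_converges \<nu> (distr P borel X)"
      unfolding weakly_converges_def
    proof (intro allI impI, elim conjE)
      fix f :: "'a \<Rightarrow> real" assume f: "continuous_on UNIV f" "bounded (range f)"
      have [measurable]: "f \<in> borel_measurable borel" using f(1) by (rule borel_measurable_continuous_onI)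
      obtain B where B: "\<And>x. \<bar>f x\<bar> \<le> B" using f(2) by (auto simp: bounded_iff)
      have "(\<lambda>n. LINT \<omega>|P. f (S n \<omega>)) \<longlonglongrightarrow> (LINT \<omega>|P. f (X \<omega>))"
      proof (rule integral_dominated_convergence[where w = "\<lambda>_. B"])
        show "AE \<omega> in P. (\<lambda>n. f (S n \<omega>)) \<longlonglongrightarrow> f (X \<omega>)"
          using lim by eventually_elim (auto intro!: continuous_on_tendsto_compose[OF f(1)])
      qed (use B in auto)
      then show "(\<lambda>n. integral\<^sup>L (\<nu> n) f) \<longlonglongrightarrow> integral\<^sup>L (distr P borel X) f"
        unfolding distr_S[symmetric] by (simp add: integral_distr)
    qed
  qed
qed

lemma moran_measure_limit:
  fixes M :: "nat \<Rightarrow> real^'n^'n" and D :: "nat \<Rightarrow> (real^'n) set"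
  defines "E \<equiv> \<lambda>n. (\<lambda>d. inverse_product M (Suc n) *v d) ` D (Suc n)"
  assumes D: "\<And>n. finite (D (Suc n))" "\<And>n. D (Suc n) \<noteq> {}"
    and bound: "\<And>n e. e \<in> E n \<Longrightarrow> norm e \<le> b n" and "summable b"
  shows "borel_prob_space (moran_measure M D)"
    and "AE x in moran_measure M D. norm x \<le> suminf b"
    and "(\<lambda>n. \<Prod>k<n. (\<Sum>e\<in>E k. character \<xi> e) / of_nat (card (E k))) \<longlonglongrightarrow> fourier (moran_measure M D) \<xi>"
proof -
  let ?\<nu> = "finite_convolution M D"
  have E: "finite (E n)" "E n \<noteq> {}" for n using D by (auto simp: E_def)
  have \<nu>_Suc: "?\<nu> (Suc n) = convolution (?\<nu> n) (point_masses (E n))" for n by (simp add: E_def)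
  obtain \<mu> where \<mu>: "borel_prob_space \<mu>" "weakly_converges ?\<nu> \<mu>" "AE x in \<mu>. norm x \<le> suminf b"
    using infinite_convolution_exists[of E b ?\<nu>, OF E bound \<open>summable b\<close> _ \<nu>_Suc] by auto
  have eq: "moran_measure M D = \<mu>"
    unfolding moran_measure_def
  proof (rule the_equality)
    show "sets \<mu> = sets borel \<and> prob_space \<mu> \<and> weakly_converges ?\<nu> \<mu>"
      using \<mu> by (simp add: borel_prob_space_def borel_prob_space_axioms_def)
  qed (use \<mu> weak_limit_unique borel_prob_spaceI in blast)
  have fin: "borel_prob_space (?\<nu> n)
      \<and> fourier (?\<nu> n) \<xi> = (\<Prod>k<n. (\<Sum>e\<in>E k. character \<xi> e) / of_nat (card (E k)))" for n \<xi>
  proof (induction n)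
    case 0
    have "prob_space (return borel (0 :: real^'n))" by (rule prob_space_return) simp
    then show ?case by (auto intro!: borel_prob_spaceI simp: fourier_def integral_return)
  next
    case (Suc n)
    have pm: "borel_prob_space (point_masses (E n))" using E by (rule prob_point_masses)
    interpret A: borel_prob_space "?\<nu> n" using Suc by blast
    interpret B: borel_prob_space "point_masses (E n)" by (rule pm)
    interpret P: pair_prob_space "?\<nu> n" "point_masses (E n)" ..
    have "prob_space (?\<nu> (Suc n))"
      unfolding \<nu>_Suc convolution_def by (rule P.prob_space_distr) simp
    then have "borel_prob_space (?\<nu> (Suc n))"
      by (rule borel_prob_spaceI) simp
    moreover have "fourier (?\<nu> (Suc n)) \<xi> = fourier (?\<nu> n) \<xi> * ((\<Sum>e\<in>E n. character \<xi> e) / of_nat (card (E n)))"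
      unfolding \<nu>_Suc fourier_convolution[OF A.borel_prob_space_axioms pm] fourier_point_masses[OF E(1)] ..
    ultimately show ?case using Suc by simp
  qed
  show "borel_prob_space (moran_measure M D)" "AE x in moran_measure M D. norm x \<le> suminf b"
    unfolding eq using \<mu> by blast+
  have "(\<lambda>n. fourier (?\<nu> n) \<xi>) \<longlonglongrightarrow> fourier \<mu> \<xi>"
    using fin \<mu> by (intro fourier_weak_limit) auto
  then show "(\<lambda>n. \<Prod>k<n. (\<Sum>e\<in>E k. character \<xi> e) / of_nat (card (E k))) \<longlonglongrightarrow> fourier (moran_measure M D) \<xi>"
    unfolding eq using fin by simp
qed

section \<open>Inverse powers of expanding matrices\<close>

text \<open>
  With \<open>z1\<close> and \<open>z2\<close> the characteristic roots, \<open>x (n + 1) - z2 * x n\<close> is geometric with ratio \<open>z1\<close>. The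
  margin between the roots and \<open>r\<close> absorbs the linear factor that appears for a double root.
\<close>

lemma linear_recurrence_decay:
  fixes x :: "nat \<Rightarrow> complex"
  assumes rec: "\<And>n. x (Suc (Suc n)) = (z1 + z2) * x (Suc n) - z1 * z2 * x n"
    and r: "cmod z1 < r" "cmod z2 < r"
  shows "\<exists>C. \<forall>n. cmod (x n) \<le> C * r ^ n"
proof -
  define K where "K = cmod (x 1 - z2 * x 0)"
  \<comment> \<open>The second bound is the one that makes the induction step close: \<open>cmod z2 * C + K \<le> C * r\<close>.\<close>
  define C where "C = max (cmod (x 0)) (K / (r - cmod z2))"
  have r0: "r > 0" using r norm_ge_zero[of z1] by linarith
  have y: "x (Suc n) - z2 * x n = z1 ^ n * (x 1 - z2 * x 0)" for n
  proof (induction n)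
    case (Suc n)
    have "x (Suc (Suc n)) - z2 * x (Suc n) = z1 * (x (Suc n) - z2 * x n)"
      by (simp add: rec algebra_simps)
    then show ?case by (simp add: Suc)
  qed simp
  have "cmod (x n) \<le> C * r ^ n" for n
  proof (induction n)
    case 0
    then show ?case by (simp add: C_def)
  next
    case (Suc n)
    have "x (Suc n) = z2 * x n + z1 ^ n * (x 1 - z2 * x 0)" using y[of n] by (simp add: algebra_simps)
    then have "cmod (x (Suc n)) \<le> cmod z2 * cmod (x n) + cmod z1 ^ n * K"
      by (metis K_def norm_triangle_ineq norm_mult norm_power)
    also have "\<dots> \<le> cmod z2 * (C * r ^ n) + r ^ n * K"
      using Suc r by (intro add_mono mult_left_mono mult_right_mono power_mono) (auto simp: K_def)
    also have "\<dots> \<le> cmod z2 * (C * r ^ n) + r ^ n * (C * (r - cmod z2))"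
    proof -
      have "K / (r - cmod z2) \<le> C" by (simp add: C_def)
      then have "K \<le> C * (r - cmod z2)" using r by (simp add: pos_divide_le_eq)
      then show ?thesis using r0 by (intro add_left_mono mult_left_mono) auto
    qed
    also have "\<dots> = C * r ^ Suc n" by (simp add: algebra_simps)
    finally show ?case .
  qed
  then show ?thesis by blast
qed

lemma matrix_inv_cancel:
  fixes A :: "real^2^2"
  assumes "det A \<noteq> 0"
  shows "A ** matrix_inv A = mat 1" "matrix_inv A ** A = mat 1"
proof -
  have "invertible A" using assms by (simp add: invertible_det_nz)
  then have "A ** matrix_inv A = mat 1 \<and> matrix_inv A ** A = mat 1"
    unfolding invertible_def matrix_inv_def by (rule someI_ex)
  then show "A ** matrix_inv A = mat 1" "matrix_inv A ** A = mat 1" by blast+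
qed

lemma matrix_inv_2:
  fixes A :: "real^2^2"
  assumes "det A \<noteq> 0"
  shows "matrix_inv A = (1 / det A) *\<^sub>R vector [vector [A$2$2, - A$1$2], vector [- A$2$1, A$1$1]]" (is "_ = ?B")
proof -
  define q where "q = det A"
  have q: "q \<noteq> 0" "A$1$1 * A$2$2 = q + A$1$2 * A$2$1" using assms by (simp_all add: q_def det_2)
  have "?B ** A = mat 1"
    unfolding q_def[symmetric] using q
    by (simp add: vec_eq_iff matrix_matrix_mult_def mat_def forall_2 sum_2 field_simps)
  then show ?thesis
    using matrix_mul_assoc[of ?B A "matrix_inv A"] matrix_inv_cancel[OF assms] by simp
qed

text \<open>
  For a root of the characteristic polynomial an eigenvector can be written down; the off-diagonal
  entries decide which formula gives a nonzero vector.
\<close>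

lemma is_eigenvalue_2:
  fixes A :: "real^2^2"
  assumes "z\<^sup>2 - of_real (A$1$1 + A$2$2) * z + of_real (det A) = 0"
  shows "is_eigenvalue A z"
proof -
  define a b c d where "a = complex_of_real (A$1$1)" and "b = complex_of_real (A$1$2)"
    and "c = complex_of_real (A$2$1)" and "d = complex_of_real (A$2$2)"
  have char: "(z - a) * (z - d) = b * c"
    using assms by (simp add: a_def b_def c_def d_def det_2 power2_eq_square algebra_simps)
  have eig: "is_eigenvalue A z"
    if "v1 \<noteq> 0 \<or> v2 \<noteq> 0" "a * v1 + b * v2 = z * v1" "c * v1 + d * v2 = z * v2" for v1 v2
  proof -
    have "(vector [v1, v2] :: complex^2) \<noteq> 0"
      using that(1) by (auto simp: vec_eq_iff forall_2)
    moreover have "map_matrix complex_of_real A *v vector [v1, v2] = z *s vector [v1, v2]"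
      using that(2,3) by (simp add: vec_eq_iff forall_2 matrix_vector_mult_def sum_2 map_matrix_def a_def b_def c_def d_def)
    ultimately show ?thesis unfolding is_eigenvalue_def by blast
  qed
  consider "b \<noteq> 0" | "c \<noteq> 0" | "b = 0" "c = 0" "z = a" | "b = 0" "c = 0" "z = d"
    using char by (cases "b = 0"; cases "c = 0") auto
  then show ?thesis
  proof cases
    case 1
    then show ?thesis by (intro eig[of b "z - a"]) (use char in \<open>auto simp: algebra_simps\<close>)
  next
    case 2
    then show ?thesis by (intro eig[of "z - d" c]) (use char in \<open>auto simp: algebra_simps\<close>)
  next
    case 3
    then show ?thesis by (intro eig[of 1 0]) auto
  next
    case 4
    then show ?thesis by (intro eig[of 0 1]) auto
  qed
qed

text \<open>
  By the Cayley-Hamilton theorem each entry of the powers of the inverse satisfies a linear recurrence whose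
  characteristic roots are the reciprocals of the eigenvalues, hence of modulus less than 1.
\<close>

lemma expanding_inverse_powers_decay:
  fixes A :: "real^2^2"
  assumes "expanding A" "det A \<noteq> 0"
  shows "\<exists>C r. 0 < r \<and> r < 1 \<and> (\<forall>n i j. \<bar>inverse_product (\<lambda>_. A) n $ i $ j\<bar> \<le> C * r ^ n)"
proof -
  define \<tau> where "\<tau> = A$1$1 + A$2$2"
  define s where "s = csqrt (of_real (\<tau>\<^sup>2 - 4 * det A))"
  define w1 w2 where "w1 = (of_real \<tau> + s) / 2" and "w2 = (of_real \<tau> - s) / 2"
  have s2: "s * s = of_real \<tau> * of_real \<tau> - 4 * of_real (det A)"
    unfolding s_def using power2_csqrt[of "of_real (\<tau>\<^sup>2 - 4 * det A)"] by (simp add: power2_eq_square)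
  have add: "w1 + w2 = of_real \<tau>" by (simp add: w1_def w2_def field_simps)
  have mult: "w1 * w2 = of_real (det A)" using s2 by (simp add: w1_def w2_def field_simps)
  have root: "w\<^sup>2 - of_real \<tau> * w + of_real (det A) = 0" if "w = w1 \<or> w = w2" for w
    using that by (auto simp: add[symmetric] mult[symmetric] power2_eq_square algebra_simps)
  have gt: "cmod w1 > 1" "cmod w2 > 1"
    using assms(1) is_eigenvalue_2[of _ A] root unfolding expanding_def \<tau>_def by auto
  define z1 z2 where "z1 = inverse w1" and "z2 = inverse w2"
  have lt: "cmod z1 < 1" "cmod z2 < 1"
    using gt by (auto simp: z1_def z2_def norm_inverse inverse_less_1_iff)
  have nz: "w1 \<noteq> 0" "w2 \<noteq> 0" using gt by auto
  have z_add: "z1 + z2 = of_real (\<tau> / det A)"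
    using nz add mult by (simp add: z1_def z2_def field_simps of_real_divide)
  have z_mult: "z1 * z2 = of_real (1 / det A)"
    using nz mult by (simp add: z1_def z2_def field_simps of_real_divide flip: mult)
  define N where "N = matrix_inv A"
  have N2: "N ** N = (\<tau> / det A) *\<^sub>R N - (1 / det A) *\<^sub>R mat 1"
  proof -
    define q where "q = det A"
    have q: "q \<noteq> 0" "A$1$1 * A$2$2 = q + A$1$2 * A$2$1" using assms by (simp_all add: q_def det_2)
    show ?thesis
      unfolding N_def matrix_inv_2[OF assms(2)] \<tau>_def unfolding q_def[symmetric] using q
      by (simp add: vec_eq_iff matrix_matrix_mult_def mat_def forall_2 sum_2 field_simps)
  qed
  let ?S = "inverse_product (\<lambda>_. A)"
  have rec: "?S (Suc (Suc n)) = (\<tau> / det A) *\<^sub>R ?S (Suc n) - (1 / det A) *\<^sub>R ?S n" for n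
  proof -
    have "?S (Suc (Suc n)) = ?S n ** (N ** N)"
      by (simp add: N_def matrix_mul_assoc)
    also have "\<dots> = (\<tau> / det A) *\<^sub>R (?S n ** N) - (1 / det A) *\<^sub>R ?S n"
      unfolding N2 by (simp add: vec_eq_iff forall_2 matrix_matrix_mult_def sum_2 mat_def algebra_simps)
    finally show ?thesis by (simp add: N_def)
  qed
  define r where "r = (1 + max (cmod z1) (cmod z2)) / 2"
  have r: "0 < r" "r < 1" "cmod z1 < r" "cmod z2 < r"
    using lt by (auto simp: r_def max_def add_pos_nonneg)
  have "\<exists>C. \<forall>n. \<bar>?S n $ i $ j\<bar> \<le> C * r ^ n" for i j
  proof -
    have "\<exists>C. \<forall>n. cmod (complex_of_real (?S n $ i $ j)) \<le> C * r ^ n"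
    proof (rule linear_recurrence_decay[OF _ r(3,4)])
      fix n
      show "complex_of_real (?S (Suc (Suc n)) $ i $ j) = (z1 + z2) * complex_of_real (?S (Suc n) $ i $ j) - z1 * z2 * complex_of_real (?S n $ i $ j)"
        unfolding z_add z_mult rec by (simp del: inverse_product.simps)
    qed
    then show ?thesis by simp
  qed
  then obtain C where C: "\<bar>?S n $ i $ j\<bar> \<le> C i j * r ^ n" for n i j by metis
  have "\<bar>?S n $ i $ j\<bar> \<le> (\<Sum>i\<in>UNIV. \<Sum>j\<in>UNIV. \<bar>C i j\<bar>) * r ^ n" for n i j
  proof -
    have "C i j \<le> \<bar>C i j\<bar>" by simp
    also have "\<dots> \<le> (\<Sum>j\<in>UNIV. \<bar>C i j\<bar>)" by (rule member_le_sum) auto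
    also have "\<dots> \<le> (\<Sum>i\<in>UNIV. \<Sum>j\<in>UNIV. \<bar>C i j\<bar>)"
      by (rule member_le_sum[of i UNIV "\<lambda>i. \<Sum>j\<in>UNIV. \<bar>C i j\<bar>"]) (auto intro: sum_nonneg)
    finally show ?thesis
      using C[of n i j] r(1) by (meson mult_right_mono order_trans zero_le_power less_imp_le)
  qed
  then show ?thesis using r by blast
qed

lemma norm_matrix_vector_mult_le:
  fixes A :: "real^2^2"
  assumes "\<And>i j. \<bar>A $ i $ j\<bar> \<le> K"
  shows "norm (A *v x) \<le> 4 * K * norm x" "norm (x v* A) \<le> 4 * K * norm x"
proof -
  have K: "K \<ge> 0" using assms[of 1 1] by linarith
  have ent: "\<bar>A $ i $ j * x $ k\<bar> \<le> K * norm x" for i j k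
    unfolding abs_mult using assms[of i j] component_le_norm_cart[of x k] K
    by (intro mult_mono) auto
  have "\<bar>(A *v x) $ i\<bar> \<le> 2 * (K * norm x)" "\<bar>(x v* A) $ i\<bar> \<le> 2 * (K * norm x)" for i
    using ent[of i 1 1] ent[of i 2 2] ent[of 1 i 1] ent[of 2 i 2]
    unfolding matrix_vector_mult_def vector_matrix_mult_def by (simp_all add: sum_2 abs_le_iff mult.commute[of "x $ _"])
  note this[of 1] this[of 2]
  moreover have "norm (A *v x) \<le> (\<Sum>i\<in>UNIV. \<bar>(A *v x) $ i\<bar>)" "norm (x v* A) \<le> (\<Sum>i\<in>UNIV. \<bar>(x v* A) $ i\<bar>)"
    by (rule norm_le_l1_cart)+
  ultimately show "norm (A *v x) \<le> 4 * K * norm x" "norm (x v* A) \<le> 4 * K * norm x"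
    unfolding sum_2 by linarith+
qed

section \<open>The zeros of the digit mask\<close>

definition integer_lattice :: "(real^2) set" where
  "integer_lattice = {v. \<forall>i. v $ i \<in> \<int>}"

definition half_lattice :: "(real^2) set" where
  "half_lattice = {v. \<forall>i. 2 * v $ i \<in> \<int>}"

text \<open>
  A transversal of the integer lattice in the half lattice.
\<close>

definition half_cosets :: "(real^2) set" where
  "half_cosets = {vector [0, 0], vector [1/2, 0], vector [0, 1/2], vector [1/2, 1/2]}"

text \<open>
  The Fourier transform of the uniform distribution on the digits.
\<close>

definition digit_mask :: "real^2 \<Rightarrow> complex" where
  "digit_mask \<eta> = (\<Sum>d\<in>digits. character \<eta> d) / 4"

lemma integer_lattice_0 [simp]: "0 \<in> integer_lattice"
  and integer_lattice_add: "x \<in> integer_lattice \<Longrightarrow> y \<in> integer_lattice \<Longrightarrow> x + y \<in> integer_lattice"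
  and integer_lattice_diff: "x \<in> integer_lattice \<Longrightarrow> y \<in> integer_lattice \<Longrightarrow> x - y \<in> integer_lattice"
  and integer_lattice_minus: "x \<in> integer_lattice \<Longrightarrow> - x \<in> integer_lattice"
  by (auto simp: integer_lattice_def)

lemma integer_lattice_scale: "x \<in> integer_lattice \<Longrightarrow> of_int n *\<^sub>R x \<in> integer_lattice"
  by (auto simp: integer_lattice_def)

lemma half_lattice_add: "x \<in> half_lattice \<Longrightarrow> y \<in> half_lattice \<Longrightarrow> x + y \<in> half_lattice"
  by (auto simp: half_lattice_def distrib_left)

lemma half_lattice_iff: "x \<in> half_lattice \<longleftrightarrow> 2 *\<^sub>R x \<in> integer_lattice"
  by (simp add: half_lattice_def integer_lattice_def)

lemma integer_subset_half: "integer_lattice \<subseteq> half_lattice"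
  by (auto simp: half_lattice_def integer_lattice_def)

lemma half_cosets_subset: "half_cosets \<subseteq> half_lattice"
  by (auto simp: half_lattice_def half_cosets_def forall_2)

lemma finite_half_cosets [simp]: "finite half_cosets"
  by (simp add: half_cosets_def)

lemma half_cosets_distinct:
  assumes "h \<in> half_cosets" "h' \<in> half_cosets" "h - h' \<in> integer_lattice"
  shows "h = h'"
proof -
  have *: False if "x \<in> \<int>" "x * 2 = 1" for x :: real
  proof -
    obtain n where "x = of_int n" using \<open>x \<in> \<int>\<close> by (rule Ints_cases)
    then have "real_of_int (n * 2) = real_of_int 1" using that(2) by simp
    then have "n * 2 = 1" by (simp only: of_int_eq_iff)
    then show False by presburger
  qed
  show ?thesis
    using assms by (auto simp: half_cosets_def integer_lattice_def forall_2 vec_eq_iff dest: *)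
qed

lemma half_cosets_add_inj: "inj_on (\<lambda>(h, k). h + k) (half_cosets \<times> integer_lattice)"
proof (rule inj_onI)
  fix u w :: "(real^2) \<times> (real^2)"
  assume uw: "u \<in> half_cosets \<times> integer_lattice" "w \<in> half_cosets \<times> integer_lattice"
    and eq: "(\<lambda>(h, k). h + k) u = (\<lambda>(h, k). h + k) w"
  have "fst u - fst w = snd w - snd u" using eq by (simp add: split_beta algebra_simps)
  then have "fst u = fst w"
    using uw by (intro half_cosets_distinct) (auto intro: integer_lattice_diff)
  then show "u = w" using eq by (simp add: prod_eq_iff split_beta)
qed

lemma half_lattice_decompose:
  assumes "x \<in> half_lattice"
  obtains h where "h \<in> half_cosets" "x - h \<in> integer_lattice"
proof -
  have half: "y \<in> \<int> \<or> y - 1/2 \<in> \<int>" if y: "2 * y \<in> \<int>" for y :: real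
  proof -
    from y obtain n where n: "2 * y = of_int n" by (rule Ints_cases)
    show ?thesis
    proof (cases "even n")
      case True
      then obtain m where "n = 2 * m" by blast
      then have "y = of_int m" using n by simp
      then show ?thesis by simp
    next
      case False
      then obtain m where "n = 2 * m + 1" using oddE by blast
      then have "y - 1/2 = of_int m" using n by simp
      then show ?thesis by (metis Ints_of_int)
    qed
  qed
  have "\<exists>h\<in>half_cosets. x - h \<in> integer_lattice"
    using half[of "x $ 1"] half[of "x $ 2"] assms
    by (auto simp: half_lattice_def half_cosets_def integer_lattice_def forall_2)
  then show ?thesis using that by blast
qed

lemma odd_scale_half_lattice:
  assumes "x \<in> half_lattice" "odd s"
  shows "of_int s *\<^sub>R x - x \<in> integer_lattice"
proof -
  obtain m where "s = 2 * m + 1" using \<open>odd s\<close> oddE by blast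
  then have "of_int s *\<^sub>R x - x = of_int m *\<^sub>R (2 *\<^sub>R x)" by (simp add: algebra_simps)
  then show ?thesis using assms(1) by (simp only: half_lattice_iff integer_lattice_scale)
qed

lemma coprime_scale_integer_lattice:
  assumes "coprime p q" "of_int p *\<^sub>R x \<in> integer_lattice" "of_int q *\<^sub>R x \<in> integer_lattice"
  shows "x \<in> integer_lattice"
proof -
  obtain a b where ab: "a * p + b * q = 1"
    using bezout_int[of p q] assms(1) by (auto simp: coprime_iff_gcd_eq_1)
  have "of_int a *\<^sub>R (of_int p *\<^sub>R x) + of_int b *\<^sub>R (of_int q *\<^sub>R x) = (of_int (a * p + b * q) :: real) *\<^sub>R x"
    by (simp add: algebra_simps)
  then have "x = of_int a *\<^sub>R (of_int p *\<^sub>R x) + of_int b *\<^sub>R (of_int q *\<^sub>R x)"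
    unfolding ab by simp
  then show ?thesis
    using integer_lattice_add[OF integer_lattice_scale[OF assms(2), of a] integer_lattice_scale[OF assms(3), of b]]
    by simp
qed

lemma sum_digits: "(\<Sum>d\<in>digits. f d)
    = f (vector [0, 0]) + f (vector [1, 0]) + f (vector [0, 1]) + f (vector [-1, -1] :: real^2)"
  for f :: "real^2 \<Rightarrow> 'a::ab_group_add"
  unfolding digits_def by (simp add: vec_eq_iff forall_2 add.assoc)

lemma sum_half_cosets: "(\<Sum>h\<in>half_cosets. f h)
    = f (vector [0, 0]) + f (vector [1/2, 0]) + f (vector [0, 1/2]) + f (vector [1/2, 1/2] :: real^2)"
  for f :: "real^2 \<Rightarrow> 'a::ab_group_add"
  unfolding half_cosets_def by (simp add: vec_eq_iff forall_2 add.assoc)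

lemma card_digits: "card digits = 4"
  unfolding digits_def by (simp add: vec_eq_iff forall_2)

lemma finite_digits [simp]: "finite digits"
  by (simp add: digits_def)

lemma digit_mask_cis:
  "digit_mask \<eta> = (1 + cis (2 * pi * \<eta> $ 1) + cis (2 * pi * \<eta> $ 2) + cnj (cis (2 * pi * \<eta> $ 1) * cis (2 * pi * \<eta> $ 2))) / 4"
  unfolding digit_mask_def sum_digits character_cis
  by (simp add: inner_vec_def sum_2 cis_cnj cis_mult algebra_simps)

lemma norm_digit_mask_le_1: "cmod (digit_mask \<eta>) \<le> 1"
proof -
  have "cmod (\<Sum>d\<in>digits. character \<eta> d) \<le> (\<Sum>d\<in>digits. 1)"
    by (rule sum_norm_le) simp
  then show ?thesis by (simp add: digit_mask_def norm_divide card_digits)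
qed

lemma digit_mask_periodic:
  assumes "k \<in> integer_lattice"
  shows "digit_mask (\<eta> + k) = digit_mask \<eta>"
proof -
  have "cis (2 * pi * (\<eta> + k) $ i) = cis (2 * pi * \<eta> $ i)" for i
    using assms by (simp add: integer_lattice_def distrib_left flip: cis_mult)
  then show ?thesis by (simp add: digit_mask_cis)
qed

lemma cis_eq_1_iff: "cis (2 * pi * x) = 1 \<longleftrightarrow> x \<in> \<int>"
proof
  assume "cis (2 * pi * x) = 1"
  then have "cos (2 * pi * x) = 1" by (simp add: complex_eq_iff)
  then obtain n where "2 * pi * x = of_int n * 2 * pi" by (auto simp: cos_one_2pi_int)
  then show "x \<in> \<int>" by simp
qed simp

text \<open>
  Let \<open>a\<close>, \<open>b\<close> and \<open>c = 1 / (a * b)\<close> be the unit numbers that are added to 1. If \<open>1 + a + b + c = 0\<close>, then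
  conjugation gives \<open>1 + a * b + b * c + c * a = 0\<close>, because \<open>a * b * c = 1\<close>, and so
  \<open>(1 + a) * (1 + b) * (1 + c) = 0\<close>. If one of the numbers is \<open>-1\<close>, the other two are
  opposite, which leaves only signs.
\<close>

lemma digit_mask_eq_0_iff: "digit_mask \<eta> = 0 \<longleftrightarrow> \<eta> \<in> half_lattice - integer_lattice"
proof -
  define a b where "a = cis (2 * pi * \<eta> $ 1)" and "b = cis (2 * pi * \<eta> $ 2)"
  have sq: "a * a = 1 \<longleftrightarrow> 2 * \<eta> $ 1 \<in> \<int>" "b * b = 1 \<longleftrightarrow> 2 * \<eta> $ 2 \<in> \<int>"
    using cis_eq_1_iff[of "2 * \<eta> $ 1"] cis_eq_1_iff[of "2 * \<eta> $ 2"]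
    by (simp_all add: a_def b_def cis_mult algebra_simps)
  have half: "\<eta> \<in> half_lattice \<longleftrightarrow> a * a = 1 \<and> b * b = 1"
    by (simp add: half_lattice_def forall_2 sq)
  have int: "\<eta> \<in> integer_lattice \<longleftrightarrow> a = 1 \<and> b = 1"
    by (simp add: integer_lattice_def forall_2 a_def b_def cis_eq_1_iff)
  have unit: "a * cnj a = 1" "b * cnj b = 1"
    by (simp_all add: a_def b_def cis_cnj cis_mult)
  have zero: "digit_mask \<eta> = 0 \<longleftrightarrow> 1 + a + b + cnj (a * b) = 0"
    unfolding digit_mask_cis a_def[symmetric] b_def[symmetric] by simp
  show ?thesis
  proof
    assume "digit_mask \<eta> = 0"
    then have s1: "1 + a + b + cnj a * cnj b = 0" by (simp add: zero)
    then have "cnj (1 + a + b + cnj a * cnj b) = 0" by simp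
    then have s2: "1 + cnj a + cnj b + a * b = 0" by simp
    have nz: "a \<noteq> 0" "b \<noteq> 0" by (auto simp: a_def b_def)
    have "(1 + a) * (1 + b) * (1 + cnj a * cnj b)
        = 1 + a + b + cnj a * cnj b + (a * b + b * cnj b * cnj a + a * cnj a * cnj b) + (a * cnj a) * (b * cnj b)"
      by (simp add: algebra_simps)
    also have "\<dots> = 0" using s1 s2 unfolding unit by (simp add: algebra_simps)
    finally consider "a = -1" | "b = -1" | "cnj a * cnj b = -1"
      by (auto simp: add_eq_0_iff)
    then have "a * a = 1 \<and> b * b = 1 \<and> \<not> (a = 1 \<and> b = 1)"
    proof cases
      case 1
      then have "b - cnj b = 0" using s1 by simp
      then show ?thesis using 1 unit(2) by auto
    next
      case 2
      then have "a - cnj a = 0" using s1 by simp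
      then show ?thesis using 2 unit(1) by auto
    next
      case 3
      then have ab: "a + b = 0" using s1 by simp
      then have b: "b = - a" by (simp only: add_eq_0_iff)
      have "cnj (cnj a * cnj b) = -1" using 3 by simp
      then have "a * a = 1" using b by simp
      then show ?thesis using b by auto
    qed
    then show "\<eta> \<in> half_lattice - integer_lattice" by (simp add: half int)
  next
    assume "\<eta> \<in> half_lattice - integer_lattice"
    then have "(a = 1 \<or> a = -1) \<and> (b = 1 \<or> b = -1)" "\<not> (a = 1 \<and> b = 1)"
      by (auto simp: half int square_eq_1_iff)
    then show "digit_mask \<eta> = 0" by (auto simp: zero)
  qed
qed

text \<open>
  The digits represent the four classes modulo 2, so this is Parseval's identity on the
  group \<open>(\<int>/2)\<^sup>2\<close>: the shifts by \<open>h\<close> multiply the four terms of the mask by its characters.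
\<close>

lemma sum_digit_mask_half_cosets: "(\<Sum>h\<in>half_cosets. (cmod (digit_mask (\<eta> + h)))\<^sup>2) = 1"
proof -
  define a b where "a = cis (2 * pi * \<eta> $ 1)" and "b = cis (2 * pi * \<eta> $ 2)"
  define c where "c = cnj (a * b)"
  have shift: "cis (2 * pi * (x + 1/2)) = - cis (2 * pi * x)" for x
    by (simp add: minus_cis distrib_left)
  have unit: "a * cnj a = 1" "b * cnj b = 1" "c * cnj c = 1"
    by (simp_all add: a_def b_def c_def cis_cnj cis_mult)
  have "complex_of_real (\<Sum>h\<in>half_cosets. (cmod (digit_mask (\<eta> + h)))\<^sup>2)
     = (\<Sum>h\<in>half_cosets. digit_mask (\<eta> + h) * cnj (digit_mask (\<eta> + h)))"
    by (simp only: of_real_sum complex_norm_square)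
  also have "\<dots> = ((1 + a + b + c) * cnj (1 + a + b + c) + (1 - a + b - c) * cnj (1 - a + b - c)
      + (1 + a - b - c) * cnj (1 + a - b - c) + (1 - a - b + c) * cnj (1 - a - b + c)) / 16"
    unfolding sum_half_cosets digit_mask_cis vector_add_component vector_2 shift add_0_right
      a_def[symmetric] b_def[symmetric]
    by (simp add: c_def field_simps)
  also have "\<dots> = (4 + 4 * (a * cnj a) + 4 * (b * cnj b) + 4 * (c * cnj c)) / 16"
    by (simp add: algebra_simps)
  also have "\<dots> = 1" unfolding unit by simp
  finally show ?thesis by (simp only: of_real_eq_1_iff)
qed

section \<open>The integer spectrum of the self-affine measure\<close>

text \<open>
  Here \<open>B\<close> stands for the transpose of the matrix \<open>M\<^sub>2\<close> and \<open>T\<close> for its inverse. The last two assumptions say that \<open>B\<close> maps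
  the half lattice onto the integer lattice, that is, that \<open>M\<^sub>2\<close> is twice a unimodular matrix; the first is
  the refinement equation of the infinite product.
\<close>

locale self_affine = borel_prob_space \<sigma> for \<sigma> :: "(real^2) measure" +
  fixes T B :: "real^2 \<Rightarrow> real^2"
  assumes refinement: "fourier \<sigma> \<eta> = digit_mask (T \<eta>) * fourier \<sigma> (T \<eta>)"
    and T_contracts: "(\<lambda>n. (T ^^ n) \<eta>) \<longlonglongrightarrow> 0"
    and T_B [simp]: "T (B x) = x" and B_T [simp]: "B (T x) = x"
    and T_add: "T (x + y) = T x + T y"
    and B_half: "x \<in> half_lattice \<Longrightarrow> B x \<in> integer_lattice"
    and T_integer: "x \<in> integer_lattice \<Longrightarrow> T x \<in> half_lattice"
begin

abbreviation \<phi> :: "real^2 \<Rightarrow> complex" where "\<phi> \<equiv> fourier \<sigma>"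

lemma fourier_iterates_tendsto: "(\<lambda>n. \<phi> ((T ^^ n) \<eta>)) \<longlonglongrightarrow> 1"
  using continuous_on_tendsto_compose[OF continuous_on_fourier T_contracts] by simp

lemma T_half_iff: "T \<eta> \<in> half_lattice \<longleftrightarrow> \<eta> \<in> integer_lattice"
  using B_half[of "T \<eta>"] T_integer by auto

lemma T_eq_0: "T x = 0 \<longleftrightarrow> x = 0"
proof -
  have "T 0 = 0" using T_add[of 0 0] by simp
  then show ?thesis by (metis B_T)
qed

text \<open>
  By the refinement equation, \<open>\<phi> \<eta>\<close> is the product of the masks at the iterates \<open>T\<^sup>n \<eta>\<close>. For \<open>\<eta>\<close> outside the integer
  lattice no iterate enters the half lattice, so no factor vanishes, and the product converges to a nonzero
  limit because \<open>\<phi>\<close> is continuous with value 1 at 0. For nonzero integral \<open>\<eta>\<close> the iterates cannot stay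
  integral, since they tend to 0 and remain nonzero; at the first exit the mask vanishes.
\<close>

lemma fourier_zero_iff: "\<phi> \<eta> = 0 \<longleftrightarrow> \<eta> \<in> integer_lattice - {0}"
proof
  assume zero: "\<phi> \<eta> = 0"
  have "\<eta> \<in> integer_lattice"
  proof (rule ccontr)
    assume out: "\<eta> \<notin> integer_lattice"
    have "(T ^^ n) \<eta> \<notin> integer_lattice \<and> \<phi> ((T ^^ n) \<eta>) = 0" for n
    proof (induction n)
      case (Suc n)
      then have "T ((T ^^ n) \<eta>) \<notin> half_lattice" by (simp add: T_half_iff)
      then have "digit_mask (T ((T ^^ n) \<eta>)) \<noteq> 0" "T ((T ^^ n) \<eta>) \<notin> integer_lattice"
        using integer_subset_half by (auto simp: digit_mask_eq_0_iff)
      then show ?case using Suc refinement[of "(T ^^ n) \<eta>"] by simp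
    qed (use zero out in simp)
    then have "(\<lambda>n. \<phi> ((T ^^ n) \<eta>)) \<longlonglongrightarrow> 0" by simp
    then have "(1::complex) = 0" by (rule LIMSEQ_unique[OF fourier_iterates_tendsto])
    then show False by simp
  qed
  then show "\<eta> \<in> integer_lattice - {0}" using zero by auto
next
  assume \<eta>: "\<eta> \<in> integer_lattice - {0}"
  show "\<phi> \<eta> = 0"
  proof (rule ccontr)
    assume nz: "\<phi> \<eta> \<noteq> 0"
    have iter: "(T ^^ n) \<eta> \<in> integer_lattice - {0} \<and> \<phi> ((T ^^ n) \<eta>) \<noteq> 0" for n
    proof (induction n)
      case (Suc n)
      let ?x = "(T ^^ n) \<eta>"
      have "digit_mask (T ?x) \<noteq> 0" "\<phi> (T ?x) \<noteq> 0" using Suc refinement[of ?x] by auto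
      moreover have "T ?x \<in> half_lattice" using Suc T_integer by blast
      ultimately have "T ?x \<in> integer_lattice" by (auto simp: digit_mask_eq_0_iff)
      then show ?case using Suc \<open>\<phi> (T ?x) \<noteq> 0\<close> by (simp add: T_eq_0)
    qed (use \<eta> nz in simp)
    have ge: "norm ((T ^^ n) \<eta>) \<ge> 1" for n
    proof -
      from iter[of n] obtain i where "(T ^^ n) \<eta> $ i \<in> \<int>" "(T ^^ n) \<eta> $ i \<noteq> 0"
        by (auto simp: integer_lattice_def vec_eq_iff)
      then have "\<bar>(T ^^ n) \<eta> $ i\<bar> \<ge> 1" by (rule Ints_nonzero_abs_ge1)
      then show ?thesis using component_le_norm_cart[of "(T ^^ n) \<eta>" i] by linarith
    qed
    have "(\<lambda>n. norm ((T ^^ n) \<eta>)) \<longlonglongrightarrow> 0" using tendsto_norm[OF T_contracts] by simp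
    then have "1 \<le> (0::real)" by (rule LIMSEQ_le_const) (use ge in auto)
    then show False by simp
  qed
qed

lemma integer_bessel:
  assumes "finite F" "F \<subseteq> integer_lattice"
  shows "(\<Sum>k\<in>F. (cmod (\<phi> (\<xi> + k)))\<^sup>2) \<le> 1"
proof -
  have "(\<Sum>k\<in>F. (cmod (\<phi> (\<xi> + k)))\<^sup>2) = (\<Sum>k\<in>uminus ` F. (cmod (\<phi> (\<xi> - k)))\<^sup>2)"
    by (subst sum.reindex) auto
  also have "\<dots> \<le> 1"
  proof (rule bessel)
    fix i j assume "i \<in> uminus ` F" "j \<in> uminus ` F" "i \<noteq> j"
    then show "\<phi> (i - j) = 0"
      using assms(2) by (auto simp: fourier_zero_iff intro!: integer_lattice_diff integer_lattice_minus)
  qed (use assms in simp)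
  finally show ?thesis .
qed

text \<open>
  The Parseval sum of an exponential with respect to the exponentials with integer frequencies in \<open>L\<^sup>2(\<sigma>)\<close>.
\<close>

definition power_sum :: "real^2 \<Rightarrow> real" where
  "power_sum \<xi> = (\<Sum>\<^sub>\<infinity>k\<in>integer_lattice. (cmod (\<phi> (\<xi> + k)))\<^sup>2)"

lemma power_sum_summable: "(\<lambda>k. (cmod (\<phi> (\<xi> + k)))\<^sup>2) summable_on integer_lattice"
  by (rule nonneg_bdd_above_summable_on) (auto intro!: bdd_aboveI[of _ 1] integer_bessel)

lemma power_sum_le_1: "power_sum \<xi> \<le> 1"
  unfolding power_sum_def
  by (rule infsum_le_finite_sums[OF power_sum_summable]) (rule integer_bessel)

lemma finite_le_power_sum:
  "finite F \<Longrightarrow> F \<subseteq> integer_lattice \<Longrightarrow> (\<Sum>k\<in>F. (cmod (\<phi> (\<xi> + k)))\<^sup>2) \<le> power_sum \<xi>"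
  unfolding power_sum_def by (rule finite_sum_le_infsum[OF power_sum_summable]) auto

lemma fourier_le_power_sum: "(cmod (\<phi> \<xi>))\<^sup>2 \<le> power_sum \<xi>"
  using finite_le_power_sum[of "{0}" \<xi>] by simp

lemma power_sum_nonneg: "0 \<le> power_sum \<xi>"
  using fourier_le_power_sum[of \<xi>] by (meson order_trans zero_le_power2)

lemma power_sum_periodic:
  assumes "k \<in> integer_lattice"
  shows "power_sum (\<xi> + k) = power_sum \<xi>"
  unfolding power_sum_def
proof (rule infsum_reindex_bij_witness[where i = "\<lambda>l. l - k" and j = "\<lambda>l. l + k"])
qed (use assms in \<open>auto intro: integer_lattice_diff integer_lattice_add simp: add_ac\<close>)

text \<open>
  The points \<open>B (h + k)\<close> with \<open>h\<close> in the transversal and integral \<open>k\<close> are distinct integer points. On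
  each coset the mask in the refinement equation is constant by periodicity.
\<close>

lemma power_sum_superharmonic:
  "power_sum \<xi> \<ge> (\<Sum>h\<in>half_cosets. (cmod (digit_mask (T \<xi> + h)))\<^sup>2 * power_sum (T \<xi> + h))"
proof -
  define f where "f x = (cmod (\<phi> (\<xi> + x)))\<^sup>2" for x
  define g where "g = (\<lambda>(h, k). B (h + k))"
  let ?P = "half_cosets \<times> integer_lattice"
  have B_inj: "B x = B y \<Longrightarrow> x = y" for x y by (metis T_B)
  have inj: "inj_on g ?P"
  proof (rule inj_onI)
    fix p q assume pq: "p \<in> ?P" "q \<in> ?P" "g p = g q"
    then have "(\<lambda>(h, k). h + k) p = (\<lambda>(h, k). h + k) q"
      by (auto simp: g_def dest: B_inj)
    then show "p = q" by (rule inj_onD[OF half_cosets_add_inj]) (use pq in auto)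
  qed
  have sub: "g ` ?P \<subseteq> integer_lattice"
    using half_cosets_subset integer_subset_half
    by (auto simp: g_def intro!: B_half half_lattice_add)
  have f_sum: "f summable_on integer_lattice"
    unfolding f_def by (rule power_sum_summable)
  have f_g: "f (g (h, k)) = (cmod (digit_mask (T \<xi> + h)))\<^sup>2 * (cmod (\<phi> (T \<xi> + h + k)))\<^sup>2"
    if "k \<in> integer_lattice" for h k
  proof -
    have "T (\<xi> + B (h + k)) = T \<xi> + h + k" by (simp add: T_add add.assoc)
    then show ?thesis
      using refinement[of "\<xi> + B (h + k)"] digit_mask_periodic[OF that, of "T \<xi> + h"]
      by (simp add: f_def g_def norm_mult power_mult_distrib)
  qed
  have fg_sum: "(f \<circ> g) summable_on ?P"
    using summable_on_reindex[OF inj] summable_on_subset_banach[OF f_sum sub] by blast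
  have "(\<Sum>h\<in>half_cosets. (cmod (digit_mask (T \<xi> + h)))\<^sup>2 * power_sum (T \<xi> + h))
      = (\<Sum>\<^sub>\<infinity>h\<in>half_cosets. \<Sum>\<^sub>\<infinity>k\<in>integer_lattice. (f \<circ> g) (h, k))"
    by (simp add: power_sum_def f_g infsum_cmult_right' cong: infsum_cong)
  also have "\<dots> = infsum (f \<circ> g) ?P"
    by (rule infsum_Sigma_banach[OF fg_sum])
  also have "\<dots> = infsum f (g ` ?P)"
    by (rule infsum_reindex[OF inj, symmetric])
  also have "\<dots> \<le> infsum f integer_lattice"
    using f_sum sub by (intro infsum_mono2 summable_on_subset_banach[OF f_sum]) (auto simp: f_def)
  also have "\<dots> = power_sum \<xi>" by (simp add: power_sum_def f_def[abs_def])
  finally show ?thesis .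
qed

text \<open>
  As a sum of nonnegative continuous functions the Parseval sum is lower semicontinuous, and by periodicity
  a minimising sequence may be taken in the unit square.
\<close>

lemma power_sum_attains_minimum: "\<exists>\<xi>. \<forall>\<eta>. power_sum \<xi> \<le> power_sum \<eta>"
proof -
  define c where "c = (INF \<eta>. power_sum \<eta>)"
  have bdd: "bdd_below (range power_sum)" by (rule bdd_belowI[of _ 0]) (auto simp: power_sum_nonneg)
  have c_le: "c \<le> power_sum \<eta>" for \<eta>
    unfolding c_def by (rule cINF_lower[OF bdd]) simp
  have "\<exists>\<xi>\<in>cbox 0 (1 :: real^2). power_sum \<xi> < c + 1 / real (Suc n)" for n
  proof -
    have "\<exists>\<eta>. power_sum \<eta> < c + 1 / real (Suc n)"
      using cINF_less_iff[of UNIV power_sum "c + 1 / real (Suc n)"] bdd unfolding c_def by simp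
    then obtain \<eta> where \<eta>: "power_sum \<eta> < c + 1 / real (Suc n)" by blast
    define k :: "real^2" where "k = (\<chi> i. - of_int \<lfloor>\<eta> $ i\<rfloor>)"
    have "k \<in> integer_lattice" by (simp add: k_def integer_lattice_def)
    moreover have "\<eta> + k \<in> cbox 0 1"
      by (auto simp: k_def mem_box_cart) linarith+
    ultimately show ?thesis using \<eta> power_sum_periodic by metis
  qed
  then obtain u where u: "\<And>n. u n \<in> cbox 0 (1 :: real^2)" "\<And>n. power_sum (u n) < c + 1 / real (Suc n)"
    by metis
  obtain \<xi> r where r: "strict_mono r" "(u \<circ> r) \<longlonglongrightarrow> \<xi>"
    using compact_cbox[of 0 "1 :: real^2"] u(1) unfolding compact_def by metis
  have "power_sum \<xi> \<le> c"
    unfolding power_sum_def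
  proof (rule infsum_le_finite_sums[OF power_sum_summable])
    fix F assume F: "finite F" "F \<subseteq> integer_lattice"
    have lim: "(\<lambda>n. \<Sum>k\<in>F. (cmod (\<phi> ((u \<circ> r) n + k)))\<^sup>2) \<longlonglongrightarrow> (\<Sum>k\<in>F. (cmod (\<phi> (\<xi> + k)))\<^sup>2)"
      by (intro tendsto_intros continuous_on_tendsto_compose[OF continuous_on_fourier] r(2)) auto
    have up: "(\<lambda>n. c + 1 / real (Suc (r n))) \<longlonglongrightarrow> c + 0"
      using LIMSEQ_subseq_LIMSEQ[OF LIMSEQ_Suc[OF lim_1_over_n] r(1)]
      by (intro tendsto_intros) (simp add: o_def)
    have "(\<Sum>k\<in>F. (cmod (\<phi> (\<xi> + k)))\<^sup>2) \<le> c + 0"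
    proof (rule LIMSEQ_le[OF lim up], intro exI[of _ 0] allI impI)
      fix n
      show "(\<Sum>k\<in>F. (cmod (\<phi> ((u \<circ> r) n + k)))\<^sup>2) \<le> c + 1 / real (Suc (r n))"
        using finite_le_power_sum[OF F, of "u (r n)"] u(2)[of "r n"] by simp
    qed
    then show "(\<Sum>k\<in>F. (cmod (\<phi> (\<xi> + k)))\<^sup>2) \<le> c" by simp
  qed
  then show ?thesis using c_le by (meson order_trans)
qed

text \<open>
  Bessel's inequality leaves only the lower bound, which is proved at a minimum \<open>\<zeta>\<close>. At an
  integral minimum the sum contains the term \<open>\<bar>\<phi> 0\<bar>\<^sup>2 = 1\<close>. At any other minimum the average
  in \<open>power_sum_superharmonic\<close> has a positive weight at \<open>T \<zeta>\<close>, which makes \<open>T \<zeta>\<close> a minimum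
  as well; by iteration the minimum bounds \<open>\<bar>\<phi>\<bar>\<^sup>2\<close> along a sequence that tends to 0.
\<close>

lemma power_sum_eq_1: "power_sum \<xi> = 1"
proof -
  obtain \<zeta> where min: "\<And>\<eta>. power_sum \<zeta> \<le> power_sum \<eta>" using power_sum_attains_minimum by blast
  have "power_sum \<zeta> \<ge> 1"
  proof (cases "\<zeta> \<in> integer_lattice")
    case True
    have "power_sum \<zeta> = power_sum 0" using power_sum_periodic[OF True, of 0] by simp
    then show ?thesis using fourier_le_power_sum[of 0] by simp
  next
    case False
    have iter: "(T ^^ n) \<zeta> \<notin> integer_lattice \<and> power_sum ((T ^^ n) \<zeta>) = power_sum \<zeta>" for n
    proof (induction n)
      case (Suc n)
      let ?x = "(T ^^ n) \<zeta>" and ?w = "\<lambda>h. (cmod (digit_mask (T ((T ^^ n) \<zeta>) + h)))\<^sup>2"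
      have out: "T ?x \<notin> half_lattice" using Suc by (simp add: T_half_iff)
      have zero: "0 \<in> half_cosets" by (simp add: half_cosets_def vec_eq_iff forall_2)
      have "(\<Sum>h\<in>half_cosets. ?w h * (power_sum (T ?x + h) - power_sum \<zeta>)) \<le> 0"
        using power_sum_superharmonic[of ?x] sum_digit_mask_half_cosets[of "T ?x"] Suc
        by (simp add: right_diff_distrib sum_subtractf flip: sum_distrib_right)
      moreover have "?w 0 * (power_sum (T ?x + 0) - power_sum \<zeta>)
          \<le> (\<Sum>h\<in>half_cosets. ?w h * (power_sum (T ?x + h) - power_sum \<zeta>))"
        using zero min by (intro member_le_sum) auto
      moreover have "?w 0 > 0" using out by (simp add: digit_mask_eq_0_iff)
      ultimately have "?w 0 * (power_sum (T ?x + 0) - power_sum \<zeta>) \<le> 0" "?w 0 > 0"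
        by linarith+
      then have "power_sum (T ?x) - power_sum \<zeta> \<le> 0"
        by (simp only: mult_le_0_iff add_0_right) linarith
      then show ?case using min[of "T ?x"] out integer_subset_half by auto
    qed (use False in simp)
    have "(\<lambda>n. (cmod (\<phi> ((T ^^ n) \<zeta>)))\<^sup>2) \<longlonglongrightarrow> (cmod 1)\<^sup>2"
      by (intro tendsto_intros fourier_iterates_tendsto)
    moreover have "(cmod (\<phi> ((T ^^ n) \<zeta>)))\<^sup>2 \<le> power_sum \<zeta>" for n
      using fourier_le_power_sum[of "(T ^^ n) \<zeta>"] iter[of n] by simp
    ultimately have "(cmod 1)\<^sup>2 \<le> power_sum \<zeta>" by (intro LIMSEQ_le_const2) auto
    then show ?thesis by simp
  qed
  then show ?thesis using min[of \<xi>] power_sum_le_1[of \<xi>] by linarith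
qed

lemma integer_parseval:
  assumes "\<epsilon> > 0"
  obtains F where "finite F" "F \<subseteq> integer_lattice" "(\<Sum>k\<in>F. (cmod (\<phi> (\<xi> + k)))\<^sup>2) > 1 - \<epsilon>"
proof -
  have "\<not> (\<forall>F. finite F \<longrightarrow> F \<subseteq> integer_lattice \<longrightarrow> (\<Sum>k\<in>F. (cmod (\<phi> (\<xi> + k)))\<^sup>2) \<le> 1 - \<epsilon>)"
    using infsum_le_finite_sums[OF power_sum_summable, of \<xi> "1 - \<epsilon>"] power_sum_eq_1[of \<xi>] assms
    unfolding power_sum_def by fastforce
  then show ?thesis using that by (auto simp: not_le)
qed

end

section \<open>Spectra of one digit mask times a self-affine factor\<close>

context self_affine
begin

text \<open>
  If \<open>q * x\<close> is integral for all \<open>x\<close> in \<open>V\<close>, the completeness sum is a part of the integer Parseval sum at \<open>q * y\<close>,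
  reduced by factors \<open>\<bar>m\<bar>\<^sup>2 \<le> 1\<close>; choosing \<open>y\<close> with \<open>m (p * y) = 0\<close> kills its term at \<open>x = 0\<close>.
  Otherwise orthogonality to a point violating this forces \<open>p * x\<close> into the half lattice for every \<open>x\<close>, which
  splits \<open>V\<close> into at most four classes on which the mask factor is constant. Two points \<open>x\<close>, \<open>x'\<close> of one class
  have both \<open>p * (x - x')\<close> and \<open>q * (x - x')\<close> integral, hence \<open>x - x'\<close> integral by coprimality. A
  class therefore contributes only the translates in \<open>q\<int>\<^sup>2\<close> to an integer Parseval sum, and
  when \<open>\<bar>q\<bar> > 1\<close> the translate by the unit vector \<open>(1,0)\<close> is missing.
\<close>

lemma no_orthogonal_complete_set:
  fixes V :: "(real^2) set" and p q :: int
  assumes odd: "odd p" "odd q" and "coprime p q" and "0 \<in> V"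
    and orth: "\<And>x y. x \<in> V \<Longrightarrow> y \<in> V \<Longrightarrow>
      of_int p *\<^sub>R (x - y) \<in> half_lattice - integer_lattice \<or> of_int q *\<^sub>R (x - y) \<in> integer_lattice"
    and complete: "\<And>y \<epsilon>. \<epsilon> > 0 \<Longrightarrow> \<exists>F. finite F \<and> F \<subseteq> V \<and>
      (\<Sum>x\<in>F. (cmod (digit_mask (of_int p *\<^sub>R (y + x))))\<^sup>2 * (cmod (\<phi> (of_int q *\<^sub>R (y + x))))\<^sup>2) > 1 - \<epsilon>"
  shows "\<bar>q\<bar> = 1"
proof (rule ccontr)
  assume q1: "\<bar>q\<bar> \<noteq> 1"
  have p0: "p \<noteq> 0" and q0: "q \<noteq> 0" using odd by auto
  let ?S = "\<lambda>y F. \<Sum>x\<in>F. (cmod (digit_mask (of_int p *\<^sub>R (y + x))))\<^sup>2 * (cmod (\<phi> (of_int q *\<^sub>R (y + x))))\<^sup>2"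
  have no_gap: False if "\<delta> > 0" "\<And>F. finite F \<Longrightarrow> F \<subseteq> V \<Longrightarrow> ?S y F \<le> 1 - \<delta>" for y \<delta>
    using complete[OF that(1), of y] that(2) by (meson not_le)
  let ?e = "vector [1, 0] :: real^2"
  have e: "?e \<in> integer_lattice" by (simp add: integer_lattice_def forall_2)
  have bessel_gap: "(\<Sum>k\<in>F. (cmod (\<phi> (z + k)))\<^sup>2) \<le> 1 - (cmod (\<phi> (z + k0)))\<^sup>2"
    if "finite F" "F \<subseteq> integer_lattice" "k0 \<in> integer_lattice" "k0 \<notin> F" for F z k0
    using integer_bessel[of "insert k0 F" z] that by simp
  show False
  proof (cases "\<forall>x\<in>V. of_int q *\<^sub>R x \<in> integer_lattice")
    case True
    \<comment> \<open>\<open>p * y\<close> is a zero of the mask, and \<open>q * y\<close> is not integral because \<open>q\<close> is odd.\<close>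
    define y where "y = (1 / (2 * of_int p)) *\<^sub>R ?e"
    have py: "of_int p *\<^sub>R y = (1/2) *\<^sub>R ?e" using p0 by (simp add: y_def)
    have "(1/2) *\<^sub>R ?e \<in> half_lattice - integer_lattice"
    proof -
      have "(1/2) *\<^sub>R ?e \<in> half_lattice" using e by (simp add: half_lattice_iff)
      moreover have "(1/2) *\<^sub>R ?e \<in> half_cosets" by (simp add: half_cosets_def vec_eq_iff forall_2)
      moreover have "0 \<in> half_cosets" by (simp add: half_cosets_def vec_eq_iff forall_2)
      ultimately show ?thesis
        using half_cosets_distinct[of "(1/2) *\<^sub>R ?e" 0] by (auto simp: vec_eq_iff forall_2)
    qed
    then have zero: "digit_mask (of_int p *\<^sub>R (y + 0)) = 0" by (simp add: py digit_mask_eq_0_iff)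
    have qy: "of_int q *\<^sub>R y \<notin> integer_lattice"
    proof
      assume "of_int q *\<^sub>R y \<in> integer_lattice"
      then have "real_of_int q / (2 * of_int p) \<in> \<int>" by (simp add: y_def integer_lattice_def forall_2)
      then obtain n where "real_of_int q / (2 * of_int p) = of_int n" by (rule Ints_cases)
      then have "real_of_int q = of_int (2 * p * n)" using p0 by (simp add: field_simps)
      then have "q = 2 * p * n" by (simp only: of_int_eq_iff)
      then show False using odd by simp
    qed
    then have pos: "(cmod (\<phi> (of_int q *\<^sub>R y)))\<^sup>2 > 0" by (simp add: fourier_zero_iff)
    show False
    proof (rule no_gap[OF pos])
      fix F assume F: "finite F" "F \<subseteq> V"
      let ?F = "F - {0}"
      have "?S y F = ?S y ?F"
        by (rule sum.mono_neutral_right) (use F(1) zero in auto)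
      also have "\<dots> \<le> (\<Sum>x\<in>?F. (cmod (\<phi> (of_int q *\<^sub>R y + of_int q *\<^sub>R x)))\<^sup>2)"
        using norm_digit_mask_le_1
        by (intro sum_mono) (auto simp: scaleR_add_right intro!: mult_left_le_one_le power_le_one)
      also have "\<dots> = (\<Sum>k\<in>(*\<^sub>R) (of_int q) ` ?F. (cmod (\<phi> (of_int q *\<^sub>R y + k)))\<^sup>2)"
        using q0 by (subst sum.reindex) (auto simp: inj_on_def)
      also have "\<dots> \<le> 1 - (cmod (\<phi> (of_int q *\<^sub>R y + 0)))\<^sup>2"
        using F True q0 by (intro bessel_gap) auto
      finally show "?S y F \<le> 1 - (cmod (\<phi> (of_int q *\<^sub>R y)))\<^sup>2" by simp
    qed
  next
    case False
    then obtain x1 where x1: "x1 \<in> V" "of_int q *\<^sub>R x1 \<notin> integer_lattice" by blast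
    have V_half: "of_int p *\<^sub>R x \<in> half_lattice" if x: "x \<in> V" for x
    proof (rule ccontr)
      assume no: "of_int p *\<^sub>R x \<notin> half_lattice"
      then have qx: "of_int q *\<^sub>R x \<in> integer_lattice" using orth[OF x \<open>0 \<in> V\<close>] by auto
      have "of_int p *\<^sub>R x1 \<in> half_lattice" using orth[OF x1(1) \<open>0 \<in> V\<close>] x1(2) by auto
      moreover have "of_int p *\<^sub>R (x - x1) \<in> half_lattice"
      proof -
        have "of_int q *\<^sub>R (x - x1) \<notin> integer_lattice"
          using integer_lattice_diff[OF qx, of "of_int q *\<^sub>R (x - x1)"] x1(2) by (auto simp: scaleR_diff_right)
        then show ?thesis using orth[OF x x1(1)] by auto
      qed
      ultimately have "of_int p *\<^sub>R x1 + of_int p *\<^sub>R (x - x1) \<in> half_lattice" by (rule half_lattice_add)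
      then show False using no by (simp add: scaleR_diff_right)
    qed
    have same_class: "x - x' \<in> integer_lattice"
      if "x \<in> V" "x' \<in> V" "of_int p *\<^sub>R (x - x') \<in> integer_lattice" for x x'
      using orth[OF that(1,2)] that(3) coprime_scale_integer_lattice[OF \<open>coprime p q\<close>] by blast
    \<comment> \<open>With this choice \<open>2 * p * q * y\<close> is not integral while \<open>2 * p * q * x\<close> is, so that \<open>q * (y + x)\<close>
      avoids the zeros of \<open>\<phi>\<close> for every \<open>x\<close> in \<open>V\<close>.\<close>
    define y where "y = (1 / (4 * of_int p * of_int q)) *\<^sub>R ?e"
    define C where "C h = {x \<in> V. of_int p *\<^sub>R x - h \<in> integer_lattice}" for h
    \<comment> \<open>For an empty class the value 0 is as good as any other point of \<open>V\<close>, since only \<open>0 < \<delta> h\<close> and \<open>\<delta> h \<le> 1\<close> are used there.\<close>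
    define rep where "rep h = (if C h = {} then 0 else (SOME x. x \<in> C h))" for h
    define \<delta> where "\<delta> h = (cmod (\<phi> (of_int q *\<^sub>R (y + rep h) + ?e)))\<^sup>2" for h
    have rep_C: "rep h \<in> C h" if "C h \<noteq> {}" for h
      using that some_in_eq[of "C h"] by (simp add: rep_def)
    have rep_V: "rep h \<in> V" for h
      using rep_C[of h] \<open>0 \<in> V\<close> by (cases "C h = {}") (auto simp: rep_def C_def)
    have \<delta>_pos: "\<delta> h > 0" for h
    proof -
      have "of_int q *\<^sub>R (y + rep h) + ?e \<notin> integer_lattice"
      proof
        assume "of_int q *\<^sub>R (y + rep h) + ?e \<in> integer_lattice"
        then have "of_int q *\<^sub>R (y + rep h) \<in> integer_lattice"
          using integer_lattice_diff[OF _ e] by force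
        then have "of_int (2 * p) *\<^sub>R (of_int q *\<^sub>R (y + rep h)) \<in> integer_lattice"
          by (rule integer_lattice_scale)
        moreover have "of_int q *\<^sub>R (2 *\<^sub>R (of_int p *\<^sub>R rep h)) \<in> integer_lattice"
          using V_half[OF rep_V] by (intro integer_lattice_scale) (simp add: half_lattice_iff)
        ultimately have "of_int (2 * p) *\<^sub>R (of_int q *\<^sub>R (y + rep h)) - of_int q *\<^sub>R (2 *\<^sub>R (of_int p *\<^sub>R rep h)) \<in> integer_lattice"
          by (rule integer_lattice_diff)
        also have "of_int (2 * p) *\<^sub>R (of_int q *\<^sub>R (y + rep h)) - of_int q *\<^sub>R (2 *\<^sub>R (of_int p *\<^sub>R rep h)) = (1/2) *\<^sub>R ?e"
          using p0 q0 by (simp add: y_def algebra_simps)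
        finally have "(1/2 :: real) \<in> \<int>" by (simp add: integer_lattice_def forall_2)
        then obtain n where "(1/2 :: real) = of_int n" by (rule Ints_cases)
        then have "real_of_int (2 * n) = of_int 1" by simp
        then have "2 * n = 1" by (simp only: of_int_eq_iff)
        then show False by presburger
      qed
      then show ?thesis by (simp add: \<delta>_def fourier_zero_iff)
    qed
    let ?m = "\<lambda>h. (cmod (digit_mask (of_int p *\<^sub>R y + h)))\<^sup>2"
    have class_bound: "(\<Sum>x\<in>G. (cmod (\<phi> (of_int q *\<^sub>R (y + x))))\<^sup>2) \<le> 1 - \<delta> h"
      if G: "finite G" "G \<subseteq> C h" for G h
    proof (cases "C h = {}")
      case True
      have "\<delta> h \<le> 1" using integer_bessel[of "{?e}" "of_int q *\<^sub>R (y + rep h)"] e by (simp add: \<delta>_def)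
      then show ?thesis using True G by simp
    next
      case False
      let ?r = "rep h" and ?f = "\<lambda>x. of_int q *\<^sub>R (x - rep h)"
      have diff: "x - ?r \<in> integer_lattice" if "x \<in> G" for x
      proof (rule same_class)
        have "of_int p *\<^sub>R x - h \<in> integer_lattice" "of_int p *\<^sub>R ?r - h \<in> integer_lattice"
          using that G rep_C[OF False] by (auto simp: C_def)
        from integer_lattice_diff[OF this] show "of_int p *\<^sub>R (x - ?r) \<in> integer_lattice"
          by (simp add: scaleR_diff_right)
      qed (use that G rep_V in \<open>auto simp: C_def\<close>)
      have "(\<Sum>x\<in>G. (cmod (\<phi> (of_int q *\<^sub>R (y + x))))\<^sup>2) = (\<Sum>k\<in>?f ` G. (cmod (\<phi> (of_int q *\<^sub>R (y + ?r) + k)))\<^sup>2)"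
        using q0 by (subst sum.reindex) (auto simp: inj_on_def algebra_simps)
      also have "\<dots> \<le> 1 - (cmod (\<phi> (of_int q *\<^sub>R (y + ?r) + ?e)))\<^sup>2"
      proof (rule bessel_gap)
        show "?e \<notin> ?f ` G"
        proof
          assume "?e \<in> ?f ` G"
          then obtain x where x: "x \<in> G" "?e = ?f x" by blast
          obtain n where "(x - ?r) $ 1 = of_int n" using diff[OF x(1)] by (auto simp: integer_lattice_def elim: Ints_cases)
          then have "real_of_int 1 = of_int (q * n)" using arg_cong[OF x(2), of "\<lambda>v. v $ 1"] by simp
          then have "1 = q * n" by (simp only: of_int_eq_iff)
          then show False using q1 by (metis abs_1 abs_mult zdvd1_eq dvd_triv_left)
        qed
      qed (use G diff e in \<open>auto intro: integer_lattice_scale\<close>)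
      finally show ?thesis by (simp add: \<delta>_def)
    qed
    have gap: "(\<Sum>h\<in>half_cosets. ?m h * \<delta> h) > 0"
    proof -
      have "\<exists>h\<in>half_cosets. ?m h \<noteq> 0"
        using sum_digit_mask_half_cosets[of "of_int p *\<^sub>R y"] by (metis (no_types, lifting) sum.neutral zero_neq_one)
      then obtain h where h: "h \<in> half_cosets" "?m h > 0" by auto
      then have "0 < ?m h * \<delta> h" using \<delta>_pos by simp
      also have "\<dots> \<le> (\<Sum>h\<in>half_cosets. ?m h * \<delta> h)"
        using h(1) \<delta>_pos by (intro member_le_sum) (auto intro!: mult_nonneg_nonneg simp: less_imp_le)
      finally show ?thesis .
    qed
    show False
    proof (rule no_gap[OF gap])
      fix F assume F: "finite F" "F \<subseteq> V"
      have cover: "F = (\<Union>h\<in>half_cosets. F \<inter> C h)"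
      proof -
        have "\<exists>h\<in>half_cosets. x \<in> C h" if "x \<in> F" for x
          using half_lattice_decompose[OF V_half, of x] that F(2) by (auto simp: C_def)
        then show ?thesis by blast
      qed
      have "?S y F = (\<Sum>h\<in>half_cosets. ?S y (F \<inter> C h))"
      proof (subst cover, rule sum.UNION_disjoint)
        show "\<forall>h\<in>half_cosets. \<forall>h'\<in>half_cosets. h \<noteq> h' \<longrightarrow> (F \<inter> C h) \<inter> (F \<inter> C h') = {}"
        proof (intro ballI impI, rule ccontr)
          fix h h' assume hh: "h \<in> half_cosets" "h' \<in> half_cosets" "h \<noteq> h'" "(F \<inter> C h) \<inter> (F \<inter> C h') \<noteq> {}"
          then obtain x where "of_int p *\<^sub>R x - h' \<in> integer_lattice" "of_int p *\<^sub>R x - h \<in> integer_lattice"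
            by (auto simp: C_def)
          from integer_lattice_diff[OF this] have "h - h' \<in> integer_lattice" by simp
          then show False using half_cosets_distinct hh by blast
        qed
      qed (use F in auto)
      also have "\<dots> = (\<Sum>h\<in>half_cosets. ?m h * (\<Sum>x\<in>F \<inter> C h. (cmod (\<phi> (of_int q *\<^sub>R (y + x))))\<^sup>2))"
      proof (intro sum.cong refl)
        fix h
        have "digit_mask (of_int p *\<^sub>R (y + x)) = digit_mask (of_int p *\<^sub>R y + h)" if "x \<in> C h" for x
        proof -
          have "of_int p *\<^sub>R (y + x) = (of_int p *\<^sub>R y + h) + (of_int p *\<^sub>R x - h)" by (simp add: scaleR_add_right)
          moreover have "of_int p *\<^sub>R x - h \<in> integer_lattice" using that by (simp add: C_def)
          ultimately show ?thesis using digit_mask_periodic by metis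
        qed
        then show "?S y (F \<inter> C h) = ?m h * (\<Sum>x\<in>F \<inter> C h. (cmod (\<phi> (of_int q *\<^sub>R (y + x))))\<^sup>2)"
          unfolding sum_distrib_left by (intro sum.cong) auto
      qed
      also have "\<dots> \<le> (\<Sum>h\<in>half_cosets. ?m h * (1 - \<delta> h))"
        using F by (intro sum_mono mult_left_mono class_bound) auto
      also have "\<dots> = 1 - (\<Sum>h\<in>half_cosets. ?m h * \<delta> h)"
        using sum_digit_mask_half_cosets[of "of_int p *\<^sub>R y"] by (simp add: right_diff_distrib sum_subtractf)
      finally show "?S y F \<le> 1 - (\<Sum>h\<in>half_cosets. ?m h * \<delta> h)" .
    qed
  qed
qed

text \<open>
  The set \<open>V\<close> of the previous lemma consists of the frequencies, measured from one of them and transported by the gcd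
  multiple of \<open>L\<close>, with reversed sign so that the transform at \<open>\<xi> - i\<close> is evaluated at \<open>y + v i\<close>.
\<close>

lemma dvd_if_spectrum:
  fixes t1 t2 :: int and L :: "real^2 \<Rightarrow> real^2"
  assumes "borel_prob_space \<mu>"
    and fourier_\<mu>: "\<And>\<xi>. fourier \<mu> \<xi> = digit_mask (of_int t1 *\<^sub>R L \<xi>) * \<phi> (of_int t2 *\<^sub>R L \<xi>)"
    and L: "linear L" "bij L"
    and odd: "odd t1" "odd t2"
    and spec: "is_spectrum \<mu> \<Lambda>"
  shows "t2 dvd t1"
proof -
  interpret M: borel_prob_space \<mu> by fact
  define g p q where "g = gcd t1 t2" and "p = t1 div g" and "q = t2 div g"
  have g: "t1 = g * p" "t2 = g * q" "g \<noteq> 0" "coprime p q"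
  proof -
    have "t1 \<noteq> 0" using odd by auto
    then show "t1 = g * p" "t2 = g * q" "g \<noteq> 0" "coprime p q"
      using div_gcd_coprime[of t1 t2] by (auto simp: g_def p_def q_def)
  qed
  obtain i0 where i0: "i0 \<in> \<Lambda>"
  proof -
    obtain F where F: "finite F" "F \<subseteq> \<Lambda>" "(\<Sum>i\<in>F. (cmod (fourier \<mu> (0 - i)))\<^sup>2) > 1 - 1/2"
      by (rule M.spectrum_complete[OF spec, of "1/2" 0]) auto
    then have "F \<noteq> {}" by auto
    then show ?thesis using F that by blast
  qed
  define v where "v i = of_int g *\<^sub>R L (i0 - i)" for i
  have L_diff: "L (x - y) = L x - L y" for x y using L(1) by (rule linear_diff)
  have v_eq: "of_int g *\<^sub>R L (i - j) = v j - v i" for i j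
    by (simp add: v_def L_diff scaleR_diff_right)
  have F_eq: "fourier \<mu> \<xi> = digit_mask (of_int p *\<^sub>R (of_int g *\<^sub>R L \<xi>)) * \<phi> (of_int q *\<^sub>R (of_int g *\<^sub>R L \<xi>))" for \<xi>
    unfolding fourier_\<mu> g(1,2) by (simp add: mult.commute)
  have v_inj: "inj v"
    using bij_is_inj[OF L(2)] g(3) by (auto simp: v_def L_diff inj_on_def)
  have "\<bar>q\<bar> = 1"
  proof (rule no_orthogonal_complete_set[where V = "v ` \<Lambda>" and p = p and q = q])
    show "odd p" "odd q" using odd g by auto
    show "coprime p q" by fact
    show "0 \<in> v ` \<Lambda>" using i0 linear_0[OF L(1)] by (auto simp: v_def intro!: image_eqI[of _ _ i0])
  next
    fix x y assume "x \<in> v ` \<Lambda>" "y \<in> v ` \<Lambda>"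
    then obtain i j where ij: "i \<in> \<Lambda>" "j \<in> \<Lambda>" "x = v i" "y = v j" by blast
    show "of_int p *\<^sub>R (x - y) \<in> half_lattice - integer_lattice \<or> of_int q *\<^sub>R (x - y) \<in> integer_lattice"
    proof (cases "i = j")
      case True
      then show ?thesis by (simp add: ij)
    next
      case False
      then have "fourier \<mu> (j - i) = 0" using M.spectrum_orthogonal[OF spec ij(2,1)] by auto
      then show ?thesis
        unfolding F_eq v_eq ij(3,4) by (auto simp: digit_mask_eq_0_iff fourier_zero_iff)
    qed
  next
    fix y and \<epsilon> :: real assume \<epsilon>: "\<epsilon> > 0"
    obtain z where z: "L z = (1 / of_int g) *\<^sub>R y"
      using bij_is_surj[OF L(2)] by (metis surjD)
    have arg: "of_int g *\<^sub>R L ((z + i0) - i) = y + v i" for i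
    proof -
      have "L ((z + i0) - i) = L z + L (i0 - i)"
        using linear_add[OF L(1), of z "i0 - i"] by (simp add: algebra_simps)
      then show ?thesis using g(3) by (simp add: z v_def scaleR_add_right)
    qed
    obtain F where F: "finite F" "F \<subseteq> \<Lambda>" "(\<Sum>i\<in>F. (cmod (fourier \<mu> ((z + i0) - i)))\<^sup>2) > 1 - \<epsilon>"
      by (rule M.spectrum_complete[OF spec \<epsilon>])
    have "(\<Sum>x\<in>v ` F. (cmod (digit_mask (of_int p *\<^sub>R (y + x))))\<^sup>2 * (cmod (\<phi> (of_int q *\<^sub>R (y + x))))\<^sup>2)
        = (\<Sum>i\<in>F. (cmod (fourier \<mu> ((z + i0) - i)))\<^sup>2)"
      using v_inj unfolding F_eq arg
      by (subst sum.reindex) (auto simp: inj_on_def norm_mult power_mult_distrib)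
    then show "\<exists>F. finite F \<and> F \<subseteq> v ` \<Lambda> \<and>
      (\<Sum>x\<in>F. (cmod (digit_mask (of_int p *\<^sub>R (y + x))))\<^sup>2 * (cmod (\<phi> (of_int q *\<^sub>R (y + x))))\<^sup>2) > 1 - \<epsilon>"
      using F by (intro exI[of _ "v ` F"]) auto
  qed
  then have "q dvd p" by (metis abs_dvd_iff one_dvd)
  then show ?thesis using g by simp
qed

text \<open>
  In the coordinates \<open>K = t2 * L\<close> the spectrum is the half lattice and \<open>t1\<close> becomes the odd number \<open>s = t1 / t2\<close>.
  Multiplication by \<open>s\<close> fixes every coset of the integer lattice in the half lattice, so the mask at \<open>s\<close> times a nonintegral half-lattice
  point vanishes, and the values of \<open>\<bar>m\<bar>\<^sup>2\<close> that weight the four Parseval sums add up to 1.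
\<close>

lemma spectrum_if_dvd:
  fixes t1 t2 :: int and L :: "real^2 \<Rightarrow> real^2"
  assumes "borel_prob_space \<mu>" and support: "AE x in \<mu>. norm x \<le> R"
    and fourier_\<mu>: "\<And>\<xi>. fourier \<mu> \<xi> = digit_mask (of_int t1 *\<^sub>R L \<xi>) * \<phi> (of_int t2 *\<^sub>R L \<xi>)"
    and L: "linear L" "bij L"
    and odd: "odd t1" "odd t2"
    and "t2 dvd t1"
  shows "is_spectrum \<mu> {i. of_int t2 *\<^sub>R L i \<in> half_lattice}"
proof -
  interpret M: borel_prob_space \<mu> by fact
  obtain s where s: "t1 = t2 * s" using \<open>t2 dvd t1\<close> by blast
  have "odd s" using odd s by simp
  have t2: "t2 \<noteq> 0" using odd by auto
  define K where "K \<xi> = of_int t2 *\<^sub>R L \<xi>" for \<xi>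
  have K_lin: "linear K" unfolding K_def using L(1) by (rule linear_compose_scale_right)
  have K_inj: "inj K" using bij_is_inj[OF L(2)] t2 by (auto simp: K_def inj_on_def)
  have K_surj: "\<exists>x. K x = y" for y
  proof -
    obtain x where "L x = (1 / of_int t2) *\<^sub>R y" using bij_is_surj[OF L(2)] by (metis surjD)
    then show ?thesis using t2 by (intro exI[of _ x]) (simp add: K_def)
  qed
  have F_eq: "fourier \<mu> \<xi> = digit_mask (of_int s *\<^sub>R K \<xi>) * \<phi> (K \<xi>)" for \<xi>
    unfolding fourier_\<mu> K_def s by (simp add: mult.commute)
  let ?\<Lambda> = "{i. K i \<in> half_lattice}"
  have "is_spectrum \<mu> ?\<Lambda>"
  proof (rule M.is_spectrumI[OF support])
    have "half_lattice \<subseteq> range (\<lambda>(a, b). vector [of_int a / 2, of_int b / 2])"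
    proof
      fix x :: "real^2" assume "x \<in> half_lattice"
      then obtain a b where "2 * x $ 1 = of_int a" "2 * x $ 2 = of_int b"
        unfolding half_lattice_def by (auto elim!: Ints_cases simp: forall_2)
      then have "x = (\<lambda>(a, b). vector [of_int a / 2, of_int b / 2]) (a, b)"
        by (simp add: vec_eq_iff forall_2)
      then show "x \<in> range (\<lambda>(a, b). vector [of_int a / 2, of_int b / 2])" by blast
    qed
    then have "countable half_lattice" by (rule countable_subset) auto
    then have "countable (K ` ?\<Lambda>)" by (rule countable_subset[rotated]) auto
    then show "countable ?\<Lambda>"
      by (rule countable_image_inj_on) (rule inj_on_subset[OF K_inj subset_UNIV])
  next
    obtain b where b: "b > 0" "\<And>x. norm (K x) \<le> b * norm x"
      using linear_bounded_pos[OF K_lin] by metis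
    have "uniform_discrete ?\<Lambda>"
      unfolding uniform_discrete_def
    proof (intro exI[of _ "1 / (2 * b)"] conjI ballI impI)
      fix x y assume xy: "x \<in> ?\<Lambda>" "y \<in> ?\<Lambda>" "dist x y < 1 / (2 * b)"
      have "norm (2 *\<^sub>R (K x - K y)) \<le> 2 * (b * norm (x - y))"
        using b(2)[of "x - y"] by (simp add: linear_diff[OF K_lin])
      also have "\<dots> < 1" using xy(3) b(1) by (simp add: dist_norm field_simps)
      finally have small: "norm (2 *\<^sub>R (K x - K y)) < 1" .
      have "2 *\<^sub>R (K x - K y) \<in> integer_lattice"
        using xy(1,2) integer_lattice_diff by (simp add: half_lattice_iff scaleR_diff_right)
      then have "(2 *\<^sub>R (K x - K y)) $ i = 0" for i
        using component_le_norm_cart[of "2 *\<^sub>R (K x - K y)" i] small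
        by (intro Ints_nonzero_abs_less1) (auto simp: integer_lattice_def)
      then have "K x = K y" by (simp add: vec_eq_iff)
      then show "x = y" using K_inj by (auto dest: injD)
    qed (use b in auto)
    then show "topological_space_class.discrete ?\<Lambda>" by (rule uniform_discrete_imp_discrete)
  next
    fix i j assume ij: "i \<in> ?\<Lambda>" "j \<in> ?\<Lambda>" "i \<noteq> j"
    let ?x = "K (i - j)"
    have eq: "?x = K i - K j" by (rule linear_diff[OF K_lin])
    have half: "?x \<in> half_lattice"
      using ij integer_lattice_diff unfolding eq by (simp add: half_lattice_iff scaleR_diff_right)
    have "?x \<noteq> 0" using ij(3) K_inj unfolding eq by (auto dest: injD)
    show "fourier \<mu> (i - j) = 0"
    proof (cases "?x \<in> integer_lattice")
      case True
      then show ?thesis using \<open>?x \<noteq> 0\<close> by (simp add: F_eq fourier_zero_iff)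
    next
      case False
      have "digit_mask ?x = 0" using half False by (simp add: digit_mask_eq_0_iff)
      then have "digit_mask (of_int s *\<^sub>R ?x) = 0"
        using digit_mask_periodic[OF odd_scale_half_lattice[OF half \<open>odd s\<close>], of ?x] by simp
      then show ?thesis by (simp add: F_eq)
    qed
  next
    fix \<xi> and \<epsilon> :: real assume "\<epsilon> > 0"
    have "\<exists>F. finite F \<and> F \<subseteq> integer_lattice \<and> (\<Sum>k\<in>F. (cmod (\<phi> (K \<xi> + h + k)))\<^sup>2) > 1 - \<epsilon> / 2" for h
      using integer_parseval[of "\<epsilon> / 2" "K \<xi> + h"] \<open>\<epsilon> > 0\<close> by (metis half_gt_zero)
    then obtain F where F: "\<And>h. finite (F h)" "\<And>h. F h \<subseteq> integer_lattice"
        "\<And>h. (\<Sum>k\<in>F h. (cmod (\<phi> (K \<xi> + h + k)))\<^sup>2) > 1 - \<epsilon> / 2" by metis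
    obtain J where J: "\<And>y. K (J y) = y" using K_surj by metis
    define g where "g = (\<lambda>(h, k). J (- (h + k)))"
    let ?P = "Sigma half_cosets F"
    have K_g: "K (g (h, k)) = - (h + k)" for h k by (simp add: g_def J)
    have g_inj: "inj_on g ?P"
    proof (rule inj_onI)
      fix u w assume uw: "u \<in> ?P" "w \<in> ?P" "g u = g w"
      then have "(\<lambda>(h, k). h + k) u = (\<lambda>(h, k). h + k) w"
        by (cases u; cases w) (metis K_g case_prod_conv neg_equal_iff_equal)
      then show "u = w"
        by (rule inj_onD[OF half_cosets_add_inj]) (use uw F(2) in auto)
    qed
    have summand: "(cmod (fourier \<mu> (\<xi> - g (h, k))))\<^sup>2
        = (cmod (digit_mask (of_int s *\<^sub>R K \<xi> + h)))\<^sup>2 * (cmod (\<phi> (K \<xi> + h + k)))\<^sup>2"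
      if hk: "h \<in> half_cosets" "k \<in> integer_lattice" for h k
    proof -
      have K: "K (\<xi> - g (h, k)) = K \<xi> + h + k" by (simp add: linear_diff[OF K_lin] K_g)
      have "of_int s *\<^sub>R (K \<xi> + h + k) = (of_int s *\<^sub>R K \<xi> + h) + ((of_int s *\<^sub>R h - h) + of_int s *\<^sub>R k)"
        by (simp add: scaleR_add_right)
      moreover have "(of_int s *\<^sub>R h - h) + of_int s *\<^sub>R k \<in> integer_lattice"
        using hk half_cosets_subset \<open>odd s\<close>
        by (intro integer_lattice_add odd_scale_half_lattice integer_lattice_scale) auto
      ultimately have "digit_mask (of_int s *\<^sub>R (K \<xi> + h + k)) = digit_mask (of_int s *\<^sub>R K \<xi> + h)"
        using digit_mask_periodic by metis
      then show ?thesis by (simp add: F_eq K norm_mult power_mult_distrib)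
    qed
    have "1 - \<epsilon> < (\<Sum>h\<in>half_cosets. (cmod (digit_mask (of_int s *\<^sub>R K \<xi> + h)))\<^sup>2 * (1 - \<epsilon> / 2))"
      using sum_digit_mask_half_cosets[of "of_int s *\<^sub>R K \<xi>"] \<open>\<epsilon> > 0\<close>
      by (simp flip: sum_distrib_right)
    also have "\<dots> \<le> (\<Sum>h\<in>half_cosets. (cmod (digit_mask (of_int s *\<^sub>R K \<xi> + h)))\<^sup>2 * (\<Sum>k\<in>F h. (cmod (\<phi> (K \<xi> + h + k)))\<^sup>2))"
      using F(3) by (intro sum_mono mult_left_mono) (auto intro: less_imp_le)
    also have "\<dots> = (\<Sum>h\<in>half_cosets. \<Sum>k\<in>F h. (cmod (fourier \<mu> (\<xi> - g (h, k))))\<^sup>2)"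
      unfolding sum_distrib_left
    proof (intro sum.cong refl)
      fix h k assume "h \<in> half_cosets" "k \<in> F h"
      then show "(cmod (digit_mask (of_int s *\<^sub>R K \<xi> + h)))\<^sup>2 * (cmod (\<phi> (K \<xi> + h + k)))\<^sup>2
          = (cmod (fourier \<mu> (\<xi> - g (h, k))))\<^sup>2"
        using summand F(2) by (metis subsetD)
    qed
    also have "\<dots> = (\<Sum>u\<in>?P. (cmod (fourier \<mu> (\<xi> - g u)))\<^sup>2)"
      using F(1) by (subst sum.Sigma) (auto intro!: sum.cong)
    also have "\<dots> = (\<Sum>i\<in>g ` ?P. (cmod (fourier \<mu> (\<xi> - i)))\<^sup>2)"
      by (subst sum.reindex[OF g_inj]) simp
    finally have "(\<Sum>i\<in>g ` ?P. (cmod (fourier \<mu> (\<xi> - i)))\<^sup>2) > 1 - \<epsilon>" .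
    moreover have "g ` ?P \<subseteq> ?\<Lambda>"
    proof
      fix i assume "i \<in> g ` ?P"
      then obtain h k where hk: "h \<in> half_cosets" "k \<in> integer_lattice" "i = g (h, k)"
        using F(2) by auto
      then have "h + k \<in> half_lattice"
        using half_cosets_subset integer_subset_half by (intro half_lattice_add) auto
      then show "i \<in> ?\<Lambda>"
        using integer_lattice_minus[of "2 *\<^sub>R (h + k)"] by (simp add: hk(3) K_g half_lattice_iff algebra_simps)
    qed
    ultimately show "\<exists>F. finite F \<and> F \<subseteq> ?\<Lambda> \<and> (\<Sum>i\<in>F. (cmod (fourier \<mu> (\<xi> - i)))\<^sup>2) > 1 - \<epsilon>"
      using F(1) by (intro exI[of _ "g ` ?P"]) auto
  qed
  then show ?thesis by (simp add: K_def)
qed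

end

section \<open>Moran measures of scaled digit sets\<close>

lemma inj_inverse_product:
  fixes M :: "nat \<Rightarrow> real^2^2"
  assumes "\<And>n. det (M (Suc n)) \<noteq> 0"
  shows "inj ((*v) (inverse_product M n))"
proof (induction n)
  case 0
  then show ?case by (simp add: inj_on_def)
next
  case (Suc n)
  let ?A = "M (Suc n)"
  have "inj ((*v) (matrix_inv ?A))"
  proof (rule injI)
    fix x y assume "matrix_inv ?A *v x = matrix_inv ?A *v y"
    then have "(?A ** matrix_inv ?A) *v x = (?A ** matrix_inv ?A) *v y"
      by (simp flip: matrix_vector_mul_assoc)
    then show "x = y" using assms by (simp add: matrix_inv_cancel)
  qed
  from inj_compose[OF Suc this] show ?case
    by (simp add: o_def matrix_vector_mul_assoc)
qed

text \<open>
  The scaled and transformed digits stay distinct, so each finite factor has the transform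
  \<open>digit_mask\<close> at the transported frequency; row vectors carry the action of the transposed matrices.
\<close>

lemma moran_digits:
  fixes M :: "nat \<Rightarrow> real^2^2" and D :: "nat \<Rightarrow> (real^2) set" and t :: "nat \<Rightarrow> int"
  assumes D: "\<And>n. D (Suc n) = (\<lambda>d. of_int (t n) *\<^sub>R d) ` digits"
    and t: "\<And>n. t n \<noteq> 0" "\<And>n. \<bar>t n\<bar> \<le> K"
    and det: "\<And>n. det (M (Suc n)) \<noteq> 0"
    and decay: "\<And>n i j. \<bar>inverse_product M (Suc n) $ i $ j\<bar> \<le> C * r ^ n" and r: "0 < r" "r < 1"
  shows "borel_prob_space (moran_measure M D)"
    and "\<exists>R. AE x in moran_measure M D. norm x \<le> R"
    and "(\<lambda>n. \<Prod>k<n. digit_mask (of_int (t k) *\<^sub>R (\<xi> v* inverse_product M (Suc k)))) \<longlonglongrightarrow> fourier (moran_measure M D) \<xi>"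
proof -
  define b where "b n = 4 * (C * r ^ n) * (of_int K * 2)" for n
  define E where "E n = (\<lambda>d. inverse_product M (Suc n) *v d) ` D (Suc n)" for n
  have E_eq: "E n = (\<lambda>d. inverse_product M (Suc n) *v (of_int (t n) *\<^sub>R d)) ` digits" for n
    unfolding E_def D image_image ..
  have C: "C * r ^ n \<ge> 0" for n using decay[of n 1 1] by linarith
  have bound: "norm e \<le> b n" if "e \<in> E n" for e n
  proof -
    obtain d where d: "d \<in> digits" "e = inverse_product M (Suc n) *v (of_int (t n) *\<^sub>R d)"
      using \<open>e \<in> E n\<close> unfolding E_eq by blast
    have "norm d \<le> 2"
      using d(1) norm_le_l1_cart[of d] by (auto simp: digits_def sum_2)
    then have "norm (of_int (t n) *\<^sub>R d) \<le> of_int K * 2"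
      using t(2)[of n] by (auto intro!: mult_mono simp flip: of_int_abs)
    then have "4 * (C * r ^ n) * norm (of_int (t n) *\<^sub>R d) \<le> b n"
      unfolding b_def using C[of n] by (intro mult_left_mono) auto
    then show ?thesis
      using norm_matrix_vector_mult_le(1)[OF decay, of n "of_int (t n) *\<^sub>R d"] by (simp add: d(2))
  qed
  have "summable b"
    unfolding b_def using r by (intro summable_mult summable_mult2 summable_geometric) simp
  have fin: "finite (D (Suc n))" "D (Suc n) \<noteq> {}" for n
    unfolding D by (auto simp: digits_def)
  note limit = moran_measure_limit[where M = M and D = D and b = b, OF fin bound[unfolded E_def] \<open>summable b\<close>]
  show "borel_prob_space (moran_measure M D)" by (rule limit(1))
  show "\<exists>R. AE x in moran_measure M D. norm x \<le> R" using limit(2) by blast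
  have factor: "(\<Sum>e\<in>E k. character \<xi> e) / of_nat (card (E k))
      = digit_mask (of_int (t k) *\<^sub>R (\<xi> v* inverse_product M (Suc k)))" for k
  proof -
    let ?f = "\<lambda>d. inverse_product M (Suc k) *v (of_int (t k) *\<^sub>R d)"
    have inj: "inj_on ?f digits"
    proof (rule inj_onI)
      fix x y assume "?f x = ?f y"
      then have "of_int (t k) *\<^sub>R x = of_int (t k) *\<^sub>R y"
        by (rule injD[OF inj_inverse_product[of M, OF det]])
      then show "x = y" using t(1)[of k] by simp
    qed
    have "character \<xi> (?f d) = character (of_int (t k) *\<^sub>R (\<xi> v* inverse_product M (Suc k))) d" for d
      unfolding character_def dot_lmul_matrix[symmetric] by simp
    then show ?thesis
      unfolding E_eq digit_mask_def card_image[OF inj] card_digits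
      by (subst sum.reindex[OF inj]) (simp del: inverse_product.simps)
  qed
  show "(\<lambda>n. \<Prod>k<n. digit_mask (of_int (t k) *\<^sub>R (\<xi> v* inverse_product M (Suc k)))) \<longlonglongrightarrow> fourier (moran_measure M D) \<xi>"
    using limit(3)[of \<xi>] unfolding E_def[symmetric] factor .
qed

lemma vector_inverse_power:
  "x v* inverse_product (\<lambda>_. A) n = ((\<lambda>y. y v* matrix_inv A) ^^ n) (x :: real^'n)"
  by (induction n) (simp_all flip: vector_matrix_mul_assoc)

text \<open>
  Splitting off the first factor of the infinite product gives the refinement equation. The
  entries of the inverse are entries of \<open>A\<close> divided by \<open>\<plusminus>4\<close>, so evenness of \<open>A\<close> makes them half integers.
\<close>

lemma self_affine_digits:
  assumes "A \<in> GL even_integers" "expanding A" "\<bar>det A\<bar> = 4"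
  shows "self_affine (moran_measure (\<lambda>_. A) (\<lambda>_. digits)) (\<lambda>x. x v* matrix_inv A) (\<lambda>x. x v* A)"
    and "(\<lambda>n. \<Prod>k<n. digit_mask (((\<lambda>x. x v* matrix_inv A) ^^ Suc k) \<xi>)) \<longlonglongrightarrow> fourier (moran_measure (\<lambda>_. A) (\<lambda>_. digits)) \<xi>"
proof -
  let ?\<sigma> = "moran_measure (\<lambda>_. A) (\<lambda>_. digits)" and ?S = "inverse_product (\<lambda>_. A)"
  define T where "T = (\<lambda>x :: real^2. x v* matrix_inv A)"
  have det: "det A \<noteq> 0" using assms(3) by auto
  obtain C r where r: "0 < r" "r < 1" and C: "\<And>n i j. \<bar>?S n $ i $ j\<bar> \<le> C * r ^ n"
    using expanding_inverse_powers_decay[OF assms(2) det] by blast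
  have decay: "\<bar>?S (Suc n) $ i $ j\<bar> \<le> (C * r) * r ^ n" for n i j
    using C[of "Suc n" i j] by (simp add: mult.assoc)
  have power: "x v* ?S n = (T ^^ n) x" for x n
    unfolding T_def by (rule vector_inverse_power)
  have digits_1: "digits = (\<lambda>d. of_int 1 *\<^sub>R d) ` digits" by simp
  note moran = moran_digits[where M = "\<lambda>_. A" and D = "\<lambda>_. digits" and t = "\<lambda>_. 1" and K = 1,
      OF digits_1 _ _ det decay r]
  have limit: "(\<lambda>n. \<Prod>k<n. digit_mask ((T ^^ Suc k) \<xi>)) \<longlonglongrightarrow> fourier ?\<sigma> \<xi>" for \<xi>
    using moran(3)[of \<xi>] unfolding power by simp
  then show "(\<lambda>n. \<Prod>k<n. digit_mask (((\<lambda>x. x v* matrix_inv A) ^^ Suc k) \<xi>)) \<longlonglongrightarrow> fourier ?\<sigma> \<xi>"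
    unfolding T_def .
  have even: "\<exists>k\<in>\<int>. A $ i $ j = 2 * k" for i j
    using assms(1) by (auto simp: GL_def even_integers_def)
  interpret borel_prob_space ?\<sigma> by (rule moran(1)) auto
  have "self_affine ?\<sigma> T (\<lambda>x. x v* A)"
  proof (unfold_locales)
    fix \<eta>
    have "(\<lambda>n. digit_mask (T \<eta>) * (\<Prod>k<n. digit_mask ((T ^^ Suc k) (T \<eta>)))) \<longlonglongrightarrow> digit_mask (T \<eta>) * fourier ?\<sigma> (T \<eta>)"
      by (intro tendsto_intros limit)
    moreover have "digit_mask (T \<eta>) * (\<Prod>k<n. digit_mask ((T ^^ Suc k) (T \<eta>))) = (\<Prod>k<Suc n. digit_mask ((T ^^ Suc k) \<eta>))" for n
      by (subst prod.lessThan_Suc_shift) (simp add: funpow_swap1)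
    ultimately have "(\<lambda>n. \<Prod>k<Suc n. digit_mask ((T ^^ Suc k) \<eta>)) \<longlonglongrightarrow> digit_mask (T \<eta>) * fourier ?\<sigma> (T \<eta>)"
      by simp
    then show "fourier ?\<sigma> \<eta> = digit_mask (T \<eta>) * fourier ?\<sigma> (T \<eta>)"
      using LIMSEQ_unique[OF LIMSEQ_Suc[OF limit]] by blast
  next
    fix \<eta>
    show "(\<lambda>n. (T ^^ n) \<eta>) \<longlonglongrightarrow> 0"
    proof (rule tendsto_norm_zero_cancel, rule tendsto_sandwich[where f = "\<lambda>_. 0" and h = "\<lambda>n. 4 * (C * r ^ n) * norm \<eta>"])
      show "\<forall>\<^sub>F n in sequentially. norm ((T ^^ n) \<eta>) \<le> 4 * (C * r ^ n) * norm \<eta>"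
        using norm_matrix_vector_mult_le(2)[OF C] by (simp add: power[symmetric])
      have "(\<lambda>n. 4 * (C * r ^ n) * norm \<eta>) \<longlonglongrightarrow> 4 * (C * 0) * norm \<eta>"
        using r by (intro tendsto_intros LIMSEQ_realpow_zero) auto
      then show "(\<lambda>n. 4 * (C * r ^ n) * norm \<eta>) \<longlonglongrightarrow> 0" by simp
    qed auto
  next
    fix x y :: "real^2"
    show "T (x v* A) = x" "(T x) v* A = x"
      using det by (simp_all add: T_def vector_matrix_mul_assoc matrix_inv_cancel)
    show "T (x + y) = T x + T y" by (simp add: T_def algebra_simps)
  next
    fix x :: "real^2" assume x: "x \<in> half_lattice"
    have "x $ i * A $ i $ j \<in> \<int>" for i j
    proof -
      obtain k where k: "k \<in> \<int>" "A $ i $ j = 2 * k" using even by blast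
      have "x $ i * A $ i $ j = (2 * x $ i) * k" by (simp add: k(2))
      then show ?thesis using x k(1) by (simp only: half_lattice_def mem_Collect_eq Ints_mult)
    qed
    then show "x v* A \<in> integer_lattice"
      by (auto simp: integer_lattice_def vector_matrix_mult_def mult.commute intro!: Ints_sum)
  next
    fix x :: "real^2" assume x: "x \<in> integer_lattice"
    have quarter: "2 * (x $ i * (c / det A)) \<in> \<int>" if "\<exists>k\<in>\<int>. c = 2 * k" for i c
    proof -
      obtain k where k: "k \<in> \<int>" "c = 2 * k" using \<open>\<exists>k\<in>\<int>. c = 2 * k\<close> by blast
      have "2 * (x $ i * (c / det A)) = x $ i * k \<or> 2 * (x $ i * (c / det A)) = - (x $ i * k)"
      proof -
        consider "det A = 4" | "det A = - 4" using assms(3) by linarith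
        then show ?thesis by cases (simp_all add: k(2))
      qed
      then show ?thesis using x k(1) by (auto simp: integer_lattice_def)
    qed
    have neg: "\<exists>k\<in>\<int>. - A $ i $ j = 2 * k" for i j
      using even[of i j] by (metis Ints_minus mult_minus_right)
    show "T x \<in> half_lattice"
      using quarter[OF even] quarter[OF neg]
      by (auto simp: half_lattice_def T_def matrix_inv_2[OF det] vector_matrix_mult_def forall_2 sum_2
          distrib_left intro!: Ints_add)
  qed
  then show "self_affine ?\<sigma> (\<lambda>x. x v* matrix_inv A) (\<lambda>x. x v* A)"
    unfolding T_def .
qed

theorem theorem1p6:
  fixes M\<^sub>1 M\<^sub>2 :: "real^2^2" and M :: "nat \<Rightarrow> real^2^2"
    and t\<^sub>1 t\<^sub>2 :: int and D :: "nat \<Rightarrow> (real^2) set"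
  assumes "M\<^sub>1 \<in> GL \<int>" and "expanding M\<^sub>1"
    and "M\<^sub>2 \<in> GL even_integers" and "expanding M\<^sub>2" and "\<bar>det M\<^sub>2\<bar> = 4"
    and "M 1 = M\<^sub>1" and "\<And>n. n \<ge> 2 \<Longrightarrow> M n = M\<^sub>2"
    and "odd t\<^sub>1" and "odd t\<^sub>2"
    and "D 1 = (\<lambda>d. of_int t\<^sub>1 *\<^sub>R d) ` digits"
    and "\<And>n. n \<ge> 2 \<Longrightarrow> D n = (\<lambda>d. of_int t\<^sub>2 *\<^sub>R d) ` digits"
  shows "spectral_measure (moran_measure M D) \<longleftrightarrow> t\<^sub>2 dvd t\<^sub>1"
proof -
  let ?\<mu> = "moran_measure M D" and ?\<sigma> = "moran_measure (\<lambda>_. M\<^sub>2) (\<lambda>_. digits)"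
  \<comment> \<open>Acting on row vectors, these are the inverse transposes of \<open>M\<^sub>2\<close> and \<open>M\<^sub>1\<close> on frequencies.\<close>
  define T where "T = (\<lambda>x :: real^2. x v* matrix_inv M\<^sub>2)"
  define L where "L = (\<lambda>x :: real^2. x v* matrix_inv M\<^sub>1)"
  define t where "t n = (if n = 0 then t\<^sub>1 else t\<^sub>2)" for n :: nat
  interpret self_affine ?\<sigma> T "\<lambda>x. x v* M\<^sub>2"
    unfolding T_def using assms(3-5) by (rule self_affine_digits(1))
  have det: "det M\<^sub>1 \<noteq> 0" "det M\<^sub>2 \<noteq> 0" using assms(1,5) by (auto simp: GL_def)
  have M_Suc: "M (Suc n) = (if n = 0 then M\<^sub>1 else M\<^sub>2)" for n
    using assms(6) assms(7)[of "Suc n"] by auto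
  have D_Suc: "D (Suc n) = (\<lambda>d. of_int (t n) *\<^sub>R d) ` digits" for n
    using assms(10) assms(11)[of "Suc n"] by (auto simp: t_def)
  have product: "inverse_product M (Suc n) = matrix_inv M\<^sub>1 ** inverse_product (\<lambda>_. M\<^sub>2) n" for n
  proof (induction n)
    case 0
    then show ?case using assms(6) by simp
  next
    case (Suc n)
    have "inverse_product M (Suc (Suc n)) = inverse_product M (Suc n) ** matrix_inv M\<^sub>2"
      by (simp only: inverse_product.simps M_Suc) simp
    then show ?case unfolding Suc by (simp add: matrix_mul_assoc)
  qed
  have action: "\<xi> v* inverse_product M (Suc n) = (T ^^ n) (L \<xi>)" for \<xi> n
    unfolding product T_def L_def vector_inverse_power[symmetric] by (simp add: vector_matrix_mul_assoc)
  obtain C r where r: "0 < r" "r < 1" and C: "\<And>n i j. \<bar>inverse_product (\<lambda>_. M\<^sub>2) n $ i $ j\<bar> \<le> C * r ^ n"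
    using expanding_inverse_powers_decay[OF assms(4) det(2)] by blast
  define B where "B = (\<Sum>i\<in>UNIV. \<Sum>j\<in>UNIV. \<bar>matrix_inv M\<^sub>1 $ i $ j\<bar>)"
  have decay: "\<bar>inverse_product M (Suc n) $ i $ j\<bar> \<le> (B * C) * r ^ n" for n i j
  proof -
    have "\<bar>inverse_product M (Suc n) $ i $ j\<bar> \<le> (\<Sum>k\<in>UNIV. \<bar>matrix_inv M\<^sub>1 $ i $ k\<bar> * (C * r ^ n))"
      unfolding product matrix_matrix_mult_def vec_lambda_beta
      by (rule order_trans[OF sum_abs], rule sum_mono) (auto simp: abs_mult C intro!: mult_left_mono)
    also have "\<dots> = (\<Sum>k\<in>UNIV. \<bar>matrix_inv M\<^sub>1 $ i $ k\<bar>) * (C * r ^ n)"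
      by (simp add: sum_distrib_right)
    also have "\<dots> \<le> B * (C * r ^ n)"
    proof (rule mult_right_mono)
      show "(\<Sum>k\<in>UNIV. \<bar>matrix_inv M\<^sub>1 $ i $ k\<bar>) \<le> B"
        unfolding B_def by (rule member_le_sum[of i UNIV "\<lambda>i. \<Sum>j\<in>UNIV. \<bar>matrix_inv M\<^sub>1 $ i $ j\<bar>"]) (auto intro: sum_nonneg)
      show "0 \<le> C * r ^ n" using C[of n 1 1] by linarith
    qed
    finally show ?thesis by (simp add: mult.assoc)
  qed
  have t: "t n \<noteq> 0" "\<bar>t n\<bar> \<le> \<bar>t\<^sub>1\<bar> + \<bar>t\<^sub>2\<bar>" for n
    using assms(8,9) by (auto simp: t_def)
  have det_Suc: "det (M (Suc n)) \<noteq> 0" for n using det by (simp add: M_Suc)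
  note moran = moran_digits[where M = M and D = D and t = t, OF D_Suc t det_Suc decay r]
  have fourier_\<mu>: "fourier ?\<mu> \<xi> = digit_mask (of_int t\<^sub>1 *\<^sub>R L \<xi>) * \<phi> (of_int t\<^sub>2 *\<^sub>R L \<xi>)" for \<xi>
  proof -
    have T_scale: "(T ^^ n) (c *\<^sub>R x) = c *\<^sub>R (T ^^ n) x" for n c x
      by (induction n) (simp_all add: T_def scaleR_vector_matrix_assoc)
    have "(\<Prod>k<Suc n. digit_mask (of_int (t k) *\<^sub>R (T ^^ k) (L \<xi>)))
        = digit_mask (of_int t\<^sub>1 *\<^sub>R L \<xi>) * (\<Prod>k<n. digit_mask ((T ^^ Suc k) (of_int t\<^sub>2 *\<^sub>R L \<xi>)))" for n
      unfolding T_scale by (subst prod.lessThan_Suc_shift) (simp add: t_def)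
    moreover have "(\<lambda>n. \<Prod>k<Suc n. digit_mask (of_int (t k) *\<^sub>R (T ^^ k) (L \<xi>))) \<longlonglongrightarrow> fourier ?\<mu> \<xi>"
      using LIMSEQ_Suc[OF moran(3)[of \<xi>]] unfolding action .
    ultimately have "(\<lambda>n. digit_mask (of_int t\<^sub>1 *\<^sub>R L \<xi>) * (\<Prod>k<n. digit_mask ((T ^^ Suc k) (of_int t\<^sub>2 *\<^sub>R L \<xi>)))) \<longlonglongrightarrow> fourier ?\<mu> \<xi>"
      by simp
    moreover have "(\<lambda>n. digit_mask (of_int t\<^sub>1 *\<^sub>R L \<xi>) * (\<Prod>k<n. digit_mask ((T ^^ Suc k) (of_int t\<^sub>2 *\<^sub>R L \<xi>))))
        \<longlonglongrightarrow> digit_mask (of_int t\<^sub>1 *\<^sub>R L \<xi>) * \<phi> (of_int t\<^sub>2 *\<^sub>R L \<xi>)"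
      unfolding T_def using assms(3-5) by (intro tendsto_intros self_affine_digits(2))
    ultimately show ?thesis by (rule LIMSEQ_unique)
  qed
  have L: "linear L" "bij L"
  proof -
    show "linear L" unfolding L_def by (rule linearI) (simp_all add: algebra_simps scaleR_vector_matrix_assoc)
    show "bij L"
      by (rule o_bij[of "\<lambda>x. x v* M\<^sub>1"])
        (simp_all add: L_def fun_eq_iff vector_matrix_mul_assoc matrix_inv_cancel det)
  qed
  show ?thesis
  proof
    assume "spectral_measure ?\<mu>"
    then obtain \<Lambda> where "is_spectrum ?\<mu> \<Lambda>" by (auto simp: spectral_measure_def)
    then show "t\<^sub>2 dvd t\<^sub>1" by (rule dvd_if_spectrum[OF moran(1) fourier_\<mu> L assms(8,9)])
  next
    assume "t\<^sub>2 dvd t\<^sub>1"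
    obtain R where "AE x in ?\<mu>. norm x \<le> R" using moran(2) by blast
    from spectrum_if_dvd[OF moran(1) this fourier_\<mu> L assms(8,9) \<open>t\<^sub>2 dvd t\<^sub>1\<close>]
    show "spectral_measure ?\<mu>"
      using borel_prob_space.sets_borel[OF moran(1)] by (auto simp: spectral_measure_def)
  qed
qed

end
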